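(* Let $\mathfrak k$ be a field, $n\ge 1$ an integer, and let $q\in\mathfrak k^*$ satisfy $q^2\ne 1$ and $[k]_q\neq 0$ for $2\le k\le n+1$. Let $A_{n+1}$ be either the Hecke algebra $H_{n+1}(q)$, or the Birman–Murakami–Wenzl algebra $BMW_{n+1}(q,\nu)$ with $\nu\in\mathfrak k\setminus\{0,q,-q^{-1}\}$ and $\nu\ne q^{2j-1}$ for $1\le j\le n$. Then the symmetrizer $S_{n+1}\in A_{n+1}$ is expressed in terms of the multiplicative 1-shuffle ${}^{q}\mathrm{Sh}_{1,n}$ alone by $$S_{n+1}=\Bigl(\frac{1}{[n+1]_q!}\;{}^{q}\mathrm{Sh}_{1,n}\Bigr)^n .$$
   Context: Notation: $[n]_q=(q^n-q^{-n})/(q-q^{-1})$, $[n]_q!=[1]_q[2]_q\cdots[n]_q$. $B_n$ is the braid group with generators $\sigma_1,\dots,\sigma_{n-1}$ and relations $\sigma_i\sigma_j\sigma_i=\sigma_j\sigma_i\sigma_j$ for $|i-j|=1$, $\sigma_i\sigma_j=\sigma_j\sigma_i$ for $|i-j|>1$. $H_n(q)$ is the quotient of $\mathfrak k B_n$ by $\sigma_i^2=(q-q^{-1})\sigma_i+1$. $BMW_n(q,\nu)$ is the quotient of $\mathfrak kB_n$ by $\kappa_i\sigma_i=\sigma_i\kappa_i=\nu\kappa_i$, $\kappa_i\sigma_{i-1}\kappa_i=\nu^{-1}\kappa_i$, $\kappa_i\sigma_{i-1}^{-1}\kappa_i=\nu\kappa_i$, where $\kappa_i$ is defined by $\sigma_i-\sigma_i^{-1}=(q-q^{-1})(1-\kappa_i)$.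 Baxterized elements: in the Hecke algebra, $\sigma_i(x)=\frac{1}{q-q^{-1}}(x\sigma_i-x^{-1}\sigma_i^{-1})$; in the BMW algebra, $$\sigma_i(x)=x^{-1}\Bigl(1+\frac{x^2-1}{q-q^{-1}}\sigma_i+\frac{x^2-1}{1-\nu^{-1}q^{-1}x^2}\kappa_i\Bigr).$$ These satisfy (known) $\sigma_i(x)\sigma_{i-1}(xy)\sigma_i(y)=\sigma_{i-1}(y)\sigma_i(xy)\sigma_{i-1}(x)$. ${}^{q}\mathrm{Sh}_{1,n}=\sigma_1(q)\sigma_2(q^2)\cdots\sigma_n(q^n)$. The symmetrizer $S_{n+1}$ is the unique non-zero element of $A_{n+1}$ with $\sigma_iS_{n+1}=S_{n+1}\sigma_i=qS_{n+1}$ for $i=1,\dots,n$ and $S_{n+1}^2=S_{n+1}$. *)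

theory Defs
  imports "HOL-Algebra.QuotRing" "HOL-Algebra.Module" "HOL-Library.Poly_Mapping"
begin

subsection \<open>Quantum numbers\<close>

definition qnum :: "'k::field \<Rightarrow> nat \<Rightarrow> 'k" where
  "qnum q n = (q ^ n - inverse q ^ n) / (q - inverse q)"

definition qfact :: "'k::field \<Rightarrow> nat \<Rightarrow> 'k" where
  "qfact q n = (\<Prod>k = 1..n. qnum q k)"


subsection \<open>The braid group\<close>

text \<open>The letter \<open>(i, True)\<close> stands for the generator with index \<open>i\<close> and \<open>(i, False)\<close> for its
  inverse.  The braid group on \<open>n\<close> strands is given by its presentation: words modulo the smallest
  congruence containing the defining relations.\<close>

type_synonym braid_word = "(nat \<times> bool) list"

definition braid_words :: "nat \<Rightarrow> braid_word set" where
  "braid_words n = lists ({1..<n} \<times> UNIV)"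

inductive_set braid_rel :: "nat \<Rightarrow> (braid_word \<times> braid_word) set" for n :: nat where
  refl: "u \<in> braid_words n \<Longrightarrow> (u, u) \<in> braid_rel n"
| sym: "(u, v) \<in> braid_rel n \<Longrightarrow> (v, u) \<in> braid_rel n"
| trans: "(u, v) \<in> braid_rel n \<Longrightarrow> (v, w) \<in> braid_rel n \<Longrightarrow> (u, w) \<in> braid_rel n"
| append: "(u, v) \<in> braid_rel n \<Longrightarrow> (u', v') \<in> braid_rel n \<Longrightarrow> (u @ u', v @ v') \<in> braid_rel n"
| cancel: "i \<in> {1..<n} \<Longrightarrow> ([(i, b), (i, \<not> b)], []) \<in> braid_rel n"
| braid: "i \<in> {1..<n} \<Longrightarrow> j \<in> {1..<n} \<Longrightarrow> \<bar>int i - int j\<bar> = 1 \<Longrightarrow>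
    ([(i, True), (j, True), (i, True)], [(j, True), (i, True), (j, True)]) \<in> braid_rel n"
| commute: "i \<in> {1..<n} \<Longrightarrow> j \<in> {1..<n} \<Longrightarrow> \<bar>int i - int j\<bar> > 1 \<Longrightarrow>
    ([(i, True), (j, True)], [(j, True), (i, True)]) \<in> braid_rel n"

definition braid_group :: "nat \<Rightarrow> braid_word set monoid" where
  "braid_group n =
    \<lparr>carrier = braid_words n // braid_rel n,
     mult = (\<lambda>U V. braid_rel n `` {u @ v | u v. u \<in> U \<and> v \<in> V}),
     one = braid_rel n `` {[]}\<rparr>"

definition braid_gen :: "nat \<Rightarrow> nat \<Rightarrow> braid_word set" where
  "braid_gen n i = braid_rel n `` {[(i, True)]}"


subsection \<open>Group algebras and quotient algebras\<close>

definition group_algebra :: "('g, 'm) monoid_scheme \<Rightarrow> ('k::field, 'g \<Rightarrow>\<^sub>0 'k) module" where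
  "group_algebra G =
    \<lparr>carrier = {f. Poly_Mapping.keys f \<subseteq> carrier G},
     mult = (\<lambda>f g. \<Sum>x\<in>Poly_Mapping.keys f. \<Sum>y\<in>Poly_Mapping.keys g.
       Poly_Mapping.single (x \<otimes>\<^bsub>G\<^esub> y) (Poly_Mapping.lookup f x * Poly_Mapping.lookup g y)),
     one = Poly_Mapping.single \<one>\<^bsub>G\<^esub> 1,
     zero = 0,
     add = (+),
     smult = (\<lambda>c. Poly_Mapping.map ((*) c))\<rparr>"

definition quotient_algebra :: "('k, 'a) module \<Rightarrow> 'a set \<Rightarrow> ('k, 'a set) module" where
  "quotient_algebra M I =
    ring.extend (M Quot I)
      (module.fields (\<lambda>c U. \<Union>x\<in>U. I +>\<^bsub>M\<^esub> (c \<odot>\<^bsub>M\<^esub> x)))"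

abbreviation braid_algebra :: "nat \<Rightarrow> ('k::field, braid_word set \<Rightarrow>\<^sub>0 'k) module" where
  "braid_algebra n \<equiv> group_algebra (braid_group n)"

definition braid_elt :: "nat \<Rightarrow> nat \<Rightarrow> braid_word set \<Rightarrow>\<^sub>0 'k::field" where
  "braid_elt n i = Poly_Mapping.single (braid_gen n i) 1"


subsection \<open>Hecke and Birman--Murakami--Wenzl algebras\<close>

text \<open>For an invertible element \<open>s\<close> of an algebra \<open>A\<close>, \<open>kappa A q s\<close> is the solution \<open>k\<close> of
  \<open>s - s\<inverse> = (q - q\<inverse>) (1 - k)\<close>.\<close>

definition kappa :: "('k::field, 'a) module \<Rightarrow> 'k \<Rightarrow> 'a \<Rightarrow> 'a" where
  "kappa A q s = \<one>\<^bsub>A\<^esub> \<ominus>\<^bsub>A\<^esub> inverse (q - inverse q) \<odot>\<^bsub>A\<^esub> (s \<ominus>\<^bsub>A\<^esub> inv\<^bsub>A\<^esub> s)"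

definition hecke_ideal :: "nat \<Rightarrow> 'k::field \<Rightarrow> (braid_word set \<Rightarrow>\<^sub>0 'k) set" where
  "hecke_ideal n q =
    (let R = braid_algebra n; s = braid_elt n in
     Idl\<^bsub>R\<^esub> {s i \<otimes>\<^bsub>R\<^esub> s i \<ominus>\<^bsub>R\<^esub> ((q - inverse q) \<odot>\<^bsub>R\<^esub> s i \<oplus>\<^bsub>R\<^esub> \<one>\<^bsub>R\<^esub>) | i. i \<in> {1..<n}})"

definition bmw_ideal :: "nat \<Rightarrow> 'k::field \<Rightarrow> 'k \<Rightarrow> (braid_word set \<Rightarrow>\<^sub>0 'k) set" where
  "bmw_ideal n q \<nu> =
    (let R = braid_algebra n; s = braid_elt n; k = (\<lambda>i. kappa R q (s i)) in
     Idl\<^bsub>R\<^esub>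
      ({k i \<otimes>\<^bsub>R\<^esub> s i \<ominus>\<^bsub>R\<^esub> \<nu> \<odot>\<^bsub>R\<^esub> k i | i. i \<in> {1..<n}} \<union>
       {s i \<otimes>\<^bsub>R\<^esub> k i \<ominus>\<^bsub>R\<^esub> \<nu> \<odot>\<^bsub>R\<^esub> k i | i. i \<in> {1..<n}} \<union>
       {k i \<otimes>\<^bsub>R\<^esub> s (i - 1) \<otimes>\<^bsub>R\<^esub> k i \<ominus>\<^bsub>R\<^esub> inverse \<nu> \<odot>\<^bsub>R\<^esub> k i | i. i \<in> {2..<n}} \<union>
       {k i \<otimes>\<^bsub>R\<^esub> inv\<^bsub>R\<^esub> (s (i - 1)) \<otimes>\<^bsub>R\<^esub> k i \<ominus>\<^bsub>R\<^esub> \<nu> \<odot>\<^bsub>R\<^esub> k i | i. i \<in> {2..<n}}))"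

definition hecke_algebra :: "nat \<Rightarrow> 'k::field \<Rightarrow> ('k, (braid_word set \<Rightarrow>\<^sub>0 'k) set) module" where
  "hecke_algebra n q = quotient_algebra (braid_algebra n) (hecke_ideal n q)"

definition bmw_algebra :: "nat \<Rightarrow> 'k::field \<Rightarrow> 'k \<Rightarrow> ('k, (braid_word set \<Rightarrow>\<^sub>0 'k) set) module" where
  "bmw_algebra n q \<nu> = quotient_algebra (braid_algebra n) (bmw_ideal n q \<nu>)"

definition hecke_gen :: "nat \<Rightarrow> 'k::field \<Rightarrow> nat \<Rightarrow> (braid_word set \<Rightarrow>\<^sub>0 'k) set" where
  "hecke_gen n q i = hecke_ideal n q +>\<^bsub>braid_algebra n\<^esub> braid_elt n i"

definition bmw_gen :: "nat \<Rightarrow> 'k::field \<Rightarrow> 'k \<Rightarrow> nat \<Rightarrow> (braid_word set \<Rightarrow>\<^sub>0 'k) set" where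
  "bmw_gen n q \<nu> i = bmw_ideal n q \<nu> +>\<^bsub>braid_algebra n\<^esub> braid_elt n i"


subsection \<open>Baxterized elements, 1-shuffles and symmetrizers\<close>

definition hecke_baxter :: "nat \<Rightarrow> 'k::field \<Rightarrow> nat \<Rightarrow> 'k \<Rightarrow> (braid_word set \<Rightarrow>\<^sub>0 'k) set" where
  "hecke_baxter n q i x =
    (let A = hecke_algebra n q; s = hecke_gen n q i in
     inverse (q - inverse q) \<odot>\<^bsub>A\<^esub> (x \<odot>\<^bsub>A\<^esub> s \<ominus>\<^bsub>A\<^esub> inverse x \<odot>\<^bsub>A\<^esub> inv\<^bsub>A\<^esub> s))"

definition bmw_baxter :: "nat \<Rightarrow> 'k::field \<Rightarrow> 'k \<Rightarrow> nat \<Rightarrow> 'k \<Rightarrow> (braid_word set \<Rightarrow>\<^sub>0 'k) set" where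
  "bmw_baxter n q \<nu> i x =
    (let A = bmw_algebra n q \<nu>; s = bmw_gen n q \<nu> i in
     inverse x \<odot>\<^bsub>A\<^esub>
      (\<one>\<^bsub>A\<^esub> \<oplus>\<^bsub>A\<^esub> ((x\<^sup>2 - 1) / (q - inverse q)) \<odot>\<^bsub>A\<^esub> s
          \<oplus>\<^bsub>A\<^esub> ((x\<^sup>2 - 1) / (1 - inverse \<nu> * inverse q * x\<^sup>2)) \<odot>\<^bsub>A\<^esub> kappa A q s))"

text \<open>The ordered product \<open>b 1 q \<cdot> b 2 q\<^sup>2 \<cdots> b n q\<^sup>n\<close>.\<close>

definition shuffle1 :: "('k::field, 'a) module \<Rightarrow> 'k \<Rightarrow> (nat \<Rightarrow> 'k \<Rightarrow> 'a) \<Rightarrow> nat \<Rightarrow> 'a" where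
  "shuffle1 A q b n = foldr (\<lambda>i a. b i (q ^ i) \<otimes>\<^bsub>A\<^esub> a) [1..<Suc n] \<one>\<^bsub>A\<^esub>"

definition is_symmetrizer ::
    "('k::field, 'a) module \<Rightarrow> 'k \<Rightarrow> (nat \<Rightarrow> 'a) \<Rightarrow> nat \<Rightarrow> 'a \<Rightarrow> bool" where
  "is_symmetrizer A q s n S \<longleftrightarrow>
    S \<in> carrier A \<and> S \<noteq> \<zero>\<^bsub>A\<^esub> \<and>
    (\<forall>i\<in>{1..n}. s i \<otimes>\<^bsub>A\<^esub> S = q \<odot>\<^bsub>A\<^esub> S \<and> S \<otimes>\<^bsub>A\<^esub> s i = q \<odot>\<^bsub>A\<^esub> S) \<and>
    S \<otimes>\<^bsub>A\<^esub> S = S"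

definition symmetrizer :: "('k::field, 'a) module \<Rightarrow> 'k \<Rightarrow> (nat \<Rightarrow> 'a) \<Rightarrow> nat \<Rightarrow> 'a" where
  "symmetrizer A q s n = (THE S. is_symmetrizer A q s n S)"

end

theory Submission
  imports Defs
begin

text \<open>
  Write \<open>T\<close> for the normalised 1-shuffle.  If \<open>s\<^sub>i Y = q Y\<close>, then
  \<open>\<sigma>\<^sub>i(x) \<sigma>\<^sub>i\<^sub>+\<^sub>1(q x) Y\<close> is an eigenvector of \<open>s\<^sub>i\<^sub>+\<^sub>1\<close> with eigenvalue \<open>q\<close>.  As \<open>s\<^sub>i\<close> commutes with
  \<open>\<sigma>\<^sub>j(x)\<close> for \<open>|i - j| > 1\<close> and \<open>s\<^sub>1 \<sigma>\<^sub>1(q) = q \<sigma>\<^sub>1(q)\<close>, each further left factor \<open>T\<close> enlarges the set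
  of generators acting by \<open>q\<close>, from \<open>s\<^sub>1, \<dots>, s\<^sub>j\<close> to \<open>s\<^sub>1, \<dots>, s\<^sub>j\<^sub>+\<^sub>1\<close>; hence \<open>s\<^sub>i T\<^sup>n = q T\<^sup>n\<close> for all
  \<open>i\<close>.  The same argument in the opposite algebra gives an element \<open>Q\<close> with \<open>Q s\<^sub>i = q Q\<close>.
  The character \<open>s\<^sub>i \<mapsto> q\<close> takes the value \<open>1\<close> on both, so \<open>T\<^sup>n = Q T\<^sup>n = Q\<close> is the symmetrizer.
\<close>

subsection \<open>Symmetrizers in algebras generated by Baxterized elements\<close>

text \<open>Why \<sigma>_i(x) \<sigma>_{i+1}(q x) Y is an eigenvector: if s_i Y = q Y, then
  \<sigma>_i(q) Y = [2]_q Y, and the Yang--Baxter equation rewrites \<sigma>_i(x) \<sigma>_{i+1}(q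
  x) \<sigma>_i(q) with \<sigma>_{i+1}(q) in front, whose image consists of q-eigenvectors of
  s_{i+1}. Neighbouring arguments q^i, q^{i+1} of the shuffle have exactly this ratio q. The proof
  checks this consequence in coordinates, at x = q^i only, so the denominators occur just at q^j
  with 1 \<le> j \<le> n; they vanish precisely when \<nu> = q^(2j-1). The condition \<nu> \<noteq>
  q separates the eigenvalue of s_i on \<kappa>_i from q, so that \<kappa>_i kills every
  q-eigenvector of s_i. Nonvanishing, normalisation and uniqueness all come from the character,
  which lives on the quotient because every defining relation lies in its kernel. Its value on
  \<sigma>_i(q^i) is [i+1]_q, whence the constant [n+1]_q!. T^n is not visibly a right eigenvector:
  moving generators through it from the right meets its factors in the wrong order. This is why Q is
  built from the reversed product.\<close>

locale scalar_algebra = ring A for A :: "('k::field, 'a) module" (structure) +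
  assumes smult_closed [simp, intro]: "x \<in> carrier A \<Longrightarrow> c \<odot> x \<in> carrier A"
    and smult_l_distr: "x \<in> carrier A \<Longrightarrow> (c + d) \<odot> x = c \<odot> x \<oplus> d \<odot> x"
    and smult_r_distr: "x \<in> carrier A \<Longrightarrow> y \<in> carrier A \<Longrightarrow> c \<odot> (x \<oplus> y) = c \<odot> x \<oplus> c \<odot> y"
    and smult_smult: "x \<in> carrier A \<Longrightarrow> c \<odot> (d \<odot> x) = (c * d) \<odot> x"
    and smult_one [simp]: "x \<in> carrier A \<Longrightarrow> 1 \<odot> x = x"
    and smult_mult: "x \<in> carrier A \<Longrightarrow> y \<in> carrier A \<Longrightarrow> (c \<odot> x) \<otimes> y = c \<odot> (x \<otimes> y)"
    and mult_smult: "x \<in> carrier A \<Longrightarrow> y \<in> carrier A \<Longrightarrow> x \<otimes> (c \<odot> y) = c \<odot> (x \<otimes> y)"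
begin

lemma smult_zero_left [simp]:
  assumes "x \<in> carrier A" shows "0 \<odot> x = \<zero>"
proof -
  have "0 \<odot> x \<oplus> 0 \<odot> x = 0 \<odot> x \<oplus> \<zero>"
    using smult_l_distr[OF assms, of 0 0] assms by simp
  then show ?thesis using assms by (simp del: r_zero)
qed

lemma smult_zero_right [simp]: "c \<odot> \<zero> = \<zero>"
proof -
  have "c \<odot> (0 \<odot> \<zero>) = \<zero>" by (subst smult_smult) auto
  then show ?thesis by simp
qed

lemma a_inv_smult: "x \<in> carrier A \<Longrightarrow> \<ominus> x = (- 1) \<odot> x"
  using smult_l_distr[of x 1 "- 1"]
  by (intro add.inv_equality) (simp_all add: a_comm)

lemma minus_smult: "x \<in> carrier A \<Longrightarrow> y \<in> carrier A \<Longrightarrow> x \<ominus> y = x \<oplus> (- 1) \<odot> y"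
  by (simp add: a_minus_def a_inv_smult)

text \<open>Subtracting and dividing by \<open>c - d\<close>. This is how a vector is shown to
  vanish: two different scalars act on it in the same way.\<close>

lemma smult_cancel:
  assumes "x \<in> carrier A" "c \<odot> x = d \<odot> x" "c \<noteq> d"
  shows "x = \<zero>"
proof -
  have "(c - d) \<odot> x = c \<odot> x \<oplus> (- d) \<odot> x"
    using assms(1) smult_l_distr[of x c "- d"] by simp
  also have "\<dots> = \<zero>"
    using assms smult_l_distr[of x d "- d"] by simp
  finally have "inverse (c - d) \<odot> ((c - d) \<odot> x) = \<zero>" by simp
  then show ?thesis using assms by (simp add: smult_smult)
qed

lemma smult_eq_iff:
  assumes "x \<in> carrier A" "y \<in> carrier A" "c \<noteq> 0"
  shows "c \<odot> x = y \<longleftrightarrow> x = inverse c \<odot> y"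
  using assms by (auto simp: smult_smult)

lemma eigen_smult:
  assumes "x \<in> carrier A" "y \<in> carrier A" "x \<otimes> y = d \<odot> y"
  shows "x \<otimes> (c \<odot> y) = d \<odot> (c \<odot> y)"
  using assms by (simp add: mult_smult smult_smult mult.commute)

text \<open>With respect to a fixed family of six vectors, identities between linear combinations become
  identities in the ground field.\<close>

definition combo :: "'a \<Rightarrow> 'a \<Rightarrow> 'a \<Rightarrow> 'a \<Rightarrow> 'a \<Rightarrow> 'a \<Rightarrow> 'k \<Rightarrow> 'k \<Rightarrow> 'k \<Rightarrow> 'k \<Rightarrow> 'k \<Rightarrow> 'k \<Rightarrow> 'a" where
  "combo u1 u2 u3 u4 u5 u6 a1 a2 a3 a4 a5 a6 =
    a1 \<odot> u1 \<oplus> (a2 \<odot> u2 \<oplus> (a3 \<odot> u3 \<oplus> (a4 \<odot> u4 \<oplus> (a5 \<odot> u5 \<oplus> a6 \<odot> u6))))"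

lemma combo_simps:
  assumes u: "u1 \<in> carrier A" "u2 \<in> carrier A" "u3 \<in> carrier A"
    "u4 \<in> carrier A" "u5 \<in> carrier A" "u6 \<in> carrier A"
  shows "combo u1 u2 u3 u4 u5 u6 a1 a2 a3 a4 a5 a6 \<in> carrier A"
    and "combo u1 u2 u3 u4 u5 u6 a1 a2 a3 a4 a5 a6 \<oplus> combo u1 u2 u3 u4 u5 u6 b1 b2 b3 b4 b5 b6
      = combo u1 u2 u3 u4 u5 u6 (a1 + b1) (a2 + b2) (a3 + b3) (a4 + b4) (a5 + b5) (a6 + b6)"
    and "c \<odot> combo u1 u2 u3 u4 u5 u6 a1 a2 a3 a4 a5 a6
      = combo u1 u2 u3 u4 u5 u6 (c * a1) (c * a2) (c * a3) (c * a4) (c * a5) (c * a6)"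
  using u by (simp_all add: combo_def smult_l_distr smult_r_distr smult_smult a_ac)

end

section \<open>The opposite algebra\<close>

definition opposite :: "('k, 'a) module \<Rightarrow> ('k, 'a) module" where
  "opposite A = A\<lparr>mult := (\<lambda>x y. y \<otimes>\<^bsub>A\<^esub> x)\<rparr>"

lemma opposite_simps [simp]:
  "carrier (opposite A) = carrier A" "x \<otimes>\<^bsub>opposite A\<^esub> y = y \<otimes>\<^bsub>A\<^esub> x"
  "\<one>\<^bsub>opposite A\<^esub> = \<one>\<^bsub>A\<^esub>" "\<zero>\<^bsub>opposite A\<^esub> = \<zero>\<^bsub>A\<^esub>"
  "x \<oplus>\<^bsub>opposite A\<^esub> y = x \<oplus>\<^bsub>A\<^esub> y" "c \<odot>\<^bsub>opposite A\<^esub> x = c \<odot>\<^bsub>A\<^esub> x"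
  by (simp_all add: opposite_def)

lemma scalar_algebra_opposite:
  assumes "scalar_algebra A" shows "scalar_algebra (opposite A)"
proof -
  interpret scalar_algebra A by fact
  have "ring (opposite A)"
  proof (intro ringI)
    show "abelian_group (opposite A)"
      using a_inv_closed l_neg by (intro abelian_groupI) (auto simp: a_ac)
    show "monoid (opposite A)"
      by (rule monoidI) (auto simp: m_assoc)
  qed (auto simp: l_distr r_distr)
  then show ?thesis
    by (intro scalar_algebra.intro scalar_algebra_axioms.intro)
      (auto simp: smult_l_distr smult_r_distr smult_smult smult_mult mult_smult)
qed

text \<open>\<open>braid_system\<close> abstracts the images of the braid generators \<open>s i\<close> and of their inverses
  \<open>r i\<close>; the character \<open>\<chi>\<close> is the one-dimensional representation in which each generator acts
  by \<open>q\<close>.\<close>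

locale braid_system = scalar_algebra A for A :: "('k::field, 'a) module" (structure) +
  fixes q :: 'k and n :: nat and s r :: "nat \<Rightarrow> 'a" and \<chi> :: "'a \<Rightarrow> 'k"
  assumes q_nz: "q \<noteq> 0" and q_sq: "q\<^sup>2 \<noteq> 1" and qnum_nz: "\<forall>k\<in>{2..n + 1}. qnum q k \<noteq> 0"
    and s_closed: "i \<in> {1..n} \<Longrightarrow> s i \<in> carrier A"
    and r_closed: "i \<in> {1..n} \<Longrightarrow> r i \<in> carrier A"
    and s_r: "i \<in> {1..n} \<Longrightarrow> s i \<otimes> r i = \<one>"
    and r_s: "i \<in> {1..n} \<Longrightarrow> r i \<otimes> s i = \<one>"
    and braid_s: "i \<in> {1..<n} \<Longrightarrow> s i \<otimes> (s (Suc i) \<otimes> s i) = s (Suc i) \<otimes> (s i \<otimes> s (Suc i))"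
    and comm_s: "i \<in> {1..n} \<Longrightarrow> j \<in> {1..n} \<Longrightarrow> \<bar>int i - int j\<bar> > 1 \<Longrightarrow> s i \<otimes> s j = s j \<otimes> s i"
    and \<chi>_add: "x \<in> carrier A \<Longrightarrow> y \<in> carrier A \<Longrightarrow> \<chi> (x \<oplus> y) = \<chi> x + \<chi> y"
    and \<chi>_mult: "x \<in> carrier A \<Longrightarrow> y \<in> carrier A \<Longrightarrow> \<chi> (x \<otimes> y) = \<chi> x * \<chi> y"
    and \<chi>_smult: "x \<in> carrier A \<Longrightarrow> \<chi> (c \<odot> x) = c * \<chi> x"
    and \<chi>_one: "\<chi> \<one> = 1"
    and \<chi>_s: "i \<in> {1..n} \<Longrightarrow> \<chi> (s i) = q"
    and generated: "\<lbrakk>B \<subseteq> carrier A; \<one> \<in> B; \<And>x y. x \<in> B \<Longrightarrow> y \<in> B \<Longrightarrow> x \<oplus> y \<in> B;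
      \<And>x y. x \<in> B \<Longrightarrow> y \<in> B \<Longrightarrow> x \<otimes> y \<in> B; \<And>c x. x \<in> B \<Longrightarrow> c \<odot> x \<in> B;
      \<And>i. i \<in> {1..n} \<Longrightarrow> s i \<in> B; \<And>i. i \<in> {1..n} \<Longrightarrow> r i \<in> B\<rbrakk> \<Longrightarrow> carrier A \<subseteq> B"
begin

lemma \<chi>_r: "i \<in> {1..n} \<Longrightarrow> \<chi> (r i) = inverse q"
  using \<chi>_mult[OF s_closed r_closed, of i i] s_r[of i] q_nz \<chi>_one \<chi>_s[of i]
  by (simp add: field_simps)

lemma \<chi>_zero: "\<chi> \<zero> = 0"
  using \<chi>_smult[of \<one> 0] by simp

lemma r_eq_of_s_eq:
  assumes "i \<in> {1..n}" "Y \<in> carrier A" "s i \<otimes> Y = q \<odot> Y"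
  shows "r i \<otimes> Y = inverse q \<odot> Y"
proof -
  have "q \<odot> (r i \<otimes> Y) = r i \<otimes> (s i \<otimes> Y)"
    using assms by (simp add: mult_smult r_closed)
  also have "\<dots> = Y"
    using assms(1,2) by (simp add: m_assoc[symmetric] r_closed s_closed r_s)
  finally show ?thesis
    using assms q_nz by (simp add: smult_eq_iff r_closed)
qed

text \<open>The elements that act on \<open>Y\<close> through \<chi> form a subalgebra containing
  every \<open>s i\<close> and \<open>r i\<close>, so \<open>generated\<close> makes it the whole
  algebra.\<close>

lemma mult_left_eq_\<chi>:
  assumes Y: "Y \<in> carrier A" "\<And>i. i \<in> {1..n} \<Longrightarrow> s i \<otimes> Y = q \<odot> Y" and a: "a \<in> carrier A"
  shows "a \<otimes> Y = \<chi> a \<odot> Y"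
proof -
  have "carrier A \<subseteq> {a \<in> carrier A. a \<otimes> Y = \<chi> a \<odot> Y}"
    by (rule generated)
      (auto simp: \<chi>_one \<chi>_add \<chi>_mult \<chi>_smult \<chi>_s \<chi>_r Y s_closed r_closed r_eq_of_s_eq l_distr
        smult_l_distr smult_mult mult_smult m_assoc smult_smult mult.commute)
  then show ?thesis using a by auto
qed

text \<open>The braid and commutation relations read the same backwards up to exchanging sides,
  \<open>s_r\<close> and \<open>r_s\<close> change places, and \<chi> takes values in a commutative
  ring. Every statement about left eigenvectors thereby yields one about right eigenvectors.\<close>

lemma braid_system_opposite: "braid_system (opposite A) q n s r \<chi>"
proof (intro braid_system.intro braid_system_axioms.intro scalar_algebra_opposite)
  show "scalar_algebra A" ..
  show "carrier (opposite A) \<subseteq> B"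
    if "B \<subseteq> carrier (opposite A)" "\<one>\<^bsub>opposite A\<^esub> \<in> B"
      "\<And>x y. x \<in> B \<Longrightarrow> y \<in> B \<Longrightarrow> x \<oplus>\<^bsub>opposite A\<^esub> y \<in> B"
      "\<And>x y. x \<in> B \<Longrightarrow> y \<in> B \<Longrightarrow> x \<otimes>\<^bsub>opposite A\<^esub> y \<in> B"
      "\<And>c x. x \<in> B \<Longrightarrow> c \<odot>\<^bsub>opposite A\<^esub> x \<in> B"
      "\<And>i. i \<in> {1..n} \<Longrightarrow> s i \<in> B" "\<And>i. i \<in> {1..n} \<Longrightarrow> r i \<in> B" for B
    using that generated[of B] by simp
qed (use q_nz q_sq qnum_nz s_closed r_closed s_r r_s braid_s comm_s
      \<chi>_add \<chi>_mult \<chi>_smult \<chi>_one \<chi>_s in \<open>auto simp: m_assoc\<close>)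

lemma mult_right_eq_\<chi>:
  assumes "Y \<in> carrier A" "\<And>i. i \<in> {1..n} \<Longrightarrow> Y \<otimes> s i = q \<odot> Y" "a \<in> carrier A"
  shows "Y \<otimes> a = \<chi> a \<odot> Y"
  using braid_system.mult_left_eq_\<chi>[OF braid_system_opposite, of Y a] assms by simp

text \<open>Idempotence fixes the normalisation:
  \<open>S = S \<otimes> S = \<chi> S \<odot> S\<close> with \<open>S\<close> nonzero.\<close>

lemma \<chi>_symmetrizer:
  assumes "is_symmetrizer A q s n S"
  shows "\<chi> S = 1"
proof (rule ccontr)
  assume "\<chi> S \<noteq> 1"
  have S: "S \<in> carrier A" "S \<noteq> \<zero>" "S \<otimes> S = S" "\<And>i. i \<in> {1..n} \<Longrightarrow> s i \<otimes> S = q \<odot> S"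
    using assms by (auto simp: is_symmetrizer_def)
  have "\<chi> S \<odot> S = 1 \<odot> S" using mult_left_eq_\<chi>[of S S] S by simp
  then show False using S \<open>\<chi> S \<noteq> 1\<close> smult_cancel by blast
qed

text \<open>A left eigenvector and a right eigenvector coincide, since their product is a multiple of
  either one.\<close>

lemma left_right_eigen_eq:
  assumes P: "P \<in> carrier A" "\<And>i. i \<in> {1..n} \<Longrightarrow> s i \<otimes> P = q \<odot> P" "\<chi> P = 1"
    and Q: "Q \<in> carrier A" "\<And>i. i \<in> {1..n} \<Longrightarrow> Q \<otimes> s i = q \<odot> Q" "\<chi> Q = 1"
  shows "P = Q"
proof -
  have "P = Q \<otimes> P" using mult_left_eq_\<chi>[OF P(1,2) Q(1)] P Q by simp
  also have "\<dots> = Q" using mult_right_eq_\<chi>[OF Q(1,2) P(1)] P Q by simp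
  finally show ?thesis .
qed

lemma is_symmetrizer_unique:
  "is_symmetrizer A q s n S \<Longrightarrow> is_symmetrizer A q s n S' \<Longrightarrow> S = S'"
  using left_right_eigen_eq[of S S'] \<chi>_symmetrizer[of S] \<chi>_symmetrizer[of S']
  by (auto simp: is_symmetrizer_def)

text \<open>The value \<open>\<chi> P = 1\<close> gives idempotence through
  \<open>P \<otimes> P = \<chi> P \<odot> P\<close> and nonvanishing through
  \<open>\<chi> \<zero> = 0\<close>; the right eigenvector property is inherited from
  \<open>Q\<close>, which equals \<open>P\<close>.\<close>

lemma is_symmetrizer_of_eigen:
  assumes P: "P \<in> carrier A" "\<And>i. i \<in> {1..n} \<Longrightarrow> s i \<otimes> P = q \<odot> P" "\<chi> P = 1"
    and Q: "Q \<in> carrier A" "\<And>i. i \<in> {1..n} \<Longrightarrow> Q \<otimes> s i = q \<odot> Q" "\<chi> Q = 1"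
  shows "is_symmetrizer A q s n P"
  using left_right_eigen_eq[OF P Q] mult_left_eq_\<chi>[OF P(1,2) P(1)] P Q \<chi>_zero
  by (auto simp: is_symmetrizer_def)

lemma qnum_nz': "k \<in> {1..n + 1} \<Longrightarrow> qnum q k \<noteq> 0"
proof (cases "k = 1")
  case True
  have "q - inverse q \<noteq> 0" using q_nz q_sq by (auto simp: field_simps power2_eq_square)
  then show ?thesis using True by (simp add: qnum_def)
qed (use qnum_nz in auto)

lemma qfact_nz: "qfact q (n + 1) \<noteq> 0"
  using qnum_nz' by (simp add: qfact_def)

end

text \<open>A common frame for both algebras: the Hecke algebra is the case \<open>k = 0\<close>, \<open>\<nu> = 0\<close>,
  \<open>\<beta> = 0\<close>.  In the names of the relations, \<open>s, r, k\<close> are the elements with index \<open>i\<close> and \<open>t, l\<close>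
  stand for \<open>s, k\<close> with index \<open>Suc i\<close>.  The list of relations is invariant under reversing
  products, so that it passes to the opposite algebra.\<close>

locale baxter_system = braid_system A q n s r \<chi>
  for A :: "('k::field, 'a) module" (structure) and q n s r \<chi> +
  fixes k :: "nat \<Rightarrow> 'a" and \<nu> z :: 'k and \<beta> :: "'k \<Rightarrow> 'k"
  assumes z: "z = q - inverse q" and \<nu>_q: "\<nu> \<noteq> q"
    and k_closed: "i \<in> {1..n} \<Longrightarrow> k i \<in> carrier A"
    and quad: "i \<in> {1..n} \<Longrightarrow> s i \<otimes> s i = \<one> \<oplus> z \<odot> s i \<oplus> (- z * \<nu>) \<odot> k i"
    and s_k: "i \<in> {1..n} \<Longrightarrow> s i \<otimes> k i = \<nu> \<odot> k i"
    and k_s: "i \<in> {1..n} \<Longrightarrow> k i \<otimes> s i = \<nu> \<odot> k i"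
    and comm_s_k: "i \<in> {1..n} \<Longrightarrow> j \<in> {1..n} \<Longrightarrow> \<bar>int i - int j\<bar> > 1 \<Longrightarrow> s i \<otimes> k j = k j \<otimes> s i"
    and r_eq: "i \<in> {1..n} \<Longrightarrow> r i = s i \<oplus> (- z) \<odot> \<one> \<oplus> z \<odot> k i"
    and kts: "i \<in> {1..<n} \<Longrightarrow> k i \<otimes> (s (Suc i) \<otimes> s i) = k i \<otimes> k (Suc i)"
    and tsl: "i \<in> {1..<n} \<Longrightarrow> s (Suc i) \<otimes> (s i \<otimes> k (Suc i)) = k i \<otimes> k (Suc i)"
    and stk: "i \<in> {1..<n} \<Longrightarrow> s i \<otimes> (s (Suc i) \<otimes> k i) = k (Suc i) \<otimes> k i"
    and lst: "i \<in> {1..<n} \<Longrightarrow> k (Suc i) \<otimes> (s i \<otimes> s (Suc i)) = k (Suc i) \<otimes> k i"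
    and stkts: "i \<in> {1..<n} \<Longrightarrow>
      s i \<otimes> (s (Suc i) \<otimes> (k i \<otimes> (s (Suc i) \<otimes> s i))) = k (Suc i)"
    and \<beta>_q: "\<beta> q * (\<nu> - q) = q * z * \<nu>"
    and \<beta>_rec: "i \<in> {1..<n} \<Longrightarrow> x = q ^ i \<Longrightarrow> y = q ^ Suc i \<Longrightarrow>
      \<beta> x * ((y\<^sup>2 - 1) / z) + q * \<beta> x * \<beta> y = q\<^sup>2 * ((x\<^sup>2 - 1) / z) * \<beta> y"
    and \<beta>_lin: "i \<in> {1..<n} \<Longrightarrow> x = q ^ i \<Longrightarrow> y = q ^ Suc i \<Longrightarrow>
      \<nu> * (\<beta> y - (y\<^sup>2 - 1)) = q * \<beta> y * x\<^sup>2"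
begin

section \<open>Baxterized elements acting on q-eigenvectors\<close>

definition sig :: "nat \<Rightarrow> 'k \<Rightarrow> 'a" where
  "sig i x = inverse x \<odot> (\<one> \<oplus> ((x\<^sup>2 - 1) / (q - inverse q)) \<odot> s i \<oplus> \<beta> x \<odot> k i)"

lemma z_nz: "z \<noteq> 0"
  using q_nz q_sq by (auto simp: z field_simps power2_eq_square)

lemma sig_closed: "i \<in> {1..n} \<Longrightarrow> sig i x \<in> carrier A"
  by (simp add: sig_def s_closed k_closed)

lemma sig_mult:
  assumes "i \<in> {1..n}" "Y \<in> carrier A"
  shows "sig i x \<otimes> Y = inverse x \<odot> (Y \<oplus> ((x\<^sup>2 - 1) / z) \<odot> (s i \<otimes> Y) \<oplus> \<beta> x \<odot> (k i \<otimes> Y))"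
  using assms by (simp add: sig_def z[symmetric] s_closed k_closed l_distr smult_mult)

text \<open>Applying \<chi> to \<open>s_k\<close> gives the factor \<open>q\<close> on one side and
  \<nu> on the other, and these differ.\<close>

lemma \<chi>_k: assumes "i \<in> {1..n}" shows "\<chi> (k i) = 0"
proof -
  have "q * \<chi> (k i) = \<nu> * \<chi> (k i)"
    using assms \<chi>_mult[of "s i" "k i"] s_k[of i] \<chi>_s[of i] \<chi>_smult[of "k i" \<nu>]
    by (auto simp: s_closed k_closed)
  then show ?thesis using \<nu>_q by simp
qed

text \<open>Since \<open>z - q = - inverse q\<close>, the two terms containing
  \<open>inverse (q ^ i)\<close> combine to \<open>- inverse q ^ Suc i\<close>, the second half of
  the quantum number.\<close>

lemma \<chi>_sig:
  assumes "i \<in> {1..n}" shows "\<chi> (sig i (q ^ i)) = qnum q (Suc i)"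
proof -
  have "\<chi> (sig i (q ^ i)) = inverse (q ^ i) * (1 + ((q ^ i)\<^sup>2 - 1) / z * q)"
    using assms by (simp add: sig_def \<chi>_smult \<chi>_add \<chi>_one \<chi>_s \<chi>_k s_closed k_closed z)
  also have "\<dots> = (inverse (q ^ i) * z + q ^ i * q - inverse (q ^ i) * q) / z"
    using z_nz q_nz by (simp add: field_simps power2_eq_square)
  also have "\<dots> = qnum q (Suc i)"
    unfolding qnum_def z[symmetric]
    by (rule arg_cong[where f = "\<lambda>u. u / z"]) (use q_nz in \<open>simp add: z field_simps\<close>)
  finally show ?thesis .
qed

text \<open>Computing \<open>k i \<otimes> (s i \<otimes> Y)\<close> from the right gives the factor
  \<open>q\<close>, from the left the factor \<nu>.\<close>

lemma k_eigen:
  assumes "i \<in> {1..n}" "Y \<in> carrier A" "s i \<otimes> Y = q \<odot> Y"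
  shows "k i \<otimes> Y = \<zero>"
proof -
  have "q \<odot> (k i \<otimes> Y) = k i \<otimes> (s i \<otimes> Y)"
    using assms by (simp add: mult_smult k_closed)
  also have "\<dots> = \<nu> \<odot> (k i \<otimes> Y)"
    using assms(1,2) by (simp add: m_assoc[symmetric] k_closed s_closed k_s smult_mult)
  finally show ?thesis using assms \<nu>_q smult_cancel[of "k i \<otimes> Y" q \<nu>] by (simp add: k_closed)
qed

text \<open>The span of \<open>Y\<close>, \<open>s i \<otimes> Y\<close> and
  \<open>k i \<otimes> Y\<close> is stable under \<open>s i\<close>, so the eigenvector equation is
  a comparison of three coefficients.\<close>

lemma s_sig_q:
  assumes i: "i \<in> {1..n}" and Y: "Y \<in> carrier A"
  shows "s i \<otimes> (sig i q \<otimes> Y) = q \<odot> (sig i q \<otimes> Y)"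
proof -
  let ?L = "combo Y (s i \<otimes> Y) (k i \<otimes> Y) \<zero> \<zero> \<zero>"
  note c = s_closed[OF i] k_closed[OF i] Y
  have q2: "(q\<^sup>2 - 1) / z = q"
    using q_nz z_nz by (simp add: z field_simps power2_eq_square)
  have ss: "s i \<otimes> (s i \<otimes> Y) = ?L 1 z (- z * \<nu>) 0 0 0"
    using c by (simp add: m_assoc[symmetric] quad[OF i] l_distr smult_mult combo_def a_ac)
  have sk: "s i \<otimes> (k i \<otimes> Y) = ?L 0 0 \<nu> 0 0 0"
    using c by (simp add: m_assoc[symmetric] s_k[OF i] smult_mult combo_def)
  have sg: "sig i q \<otimes> Y = inverse q \<odot> ?L 1 q (\<beta> q) 0 0 0"
    using c by (simp add: sig_mult[OF i Y] q2 combo_def a_ac)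
  have "s i \<otimes> ?L 1 q (\<beta> q) 0 0 0 = ?L 0 1 0 0 0 0 \<oplus> (q \<odot> (s i \<otimes> (s i \<otimes> Y)) \<oplus> \<beta> q \<odot> (s i \<otimes> (k i \<otimes> Y)))"
    using c by (simp add: combo_def r_distr mult_smult)
  also have "\<dots> = ?L q (1 + q * z) (\<beta> q * \<nu> - q * z * \<nu>) 0 0 0"
    unfolding ss sk using c by (simp add: combo_simps algebra_simps)
  also have "\<dots> = q \<odot> ?L 1 q (\<beta> q) 0 0 0"
  proof -
    \<comment> \<open>These are the coefficients of \<open>s i \<otimes> Y\<close> and
      \<open>k i \<otimes> Y\<close>; the second is the condition that the assumption
      \<open>\<beta>_q\<close> encodes.\<close>
    have "1 + q * z = q * q" using q_nz by (simp add: z field_simps)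
    moreover have "\<beta> q * \<nu> - q * z * \<nu> = q * \<beta> q" using \<beta>_q by (simp add: algebra_simps)
    ultimately show ?thesis using c by (simp add: combo_simps)
  qed
  finally show ?thesis unfolding sg using c by (intro eigen_smult combo_simps) auto
qed

lemma s_sig_comm:
  assumes i: "i \<in> {1..n}" and j: "j \<in> {1..n}" and ij: "\<bar>int i - int j\<bar> > 1"
    and Y: "Y \<in> carrier A" "s i \<otimes> Y = q \<odot> Y"
  shows "s i \<otimes> (sig j x \<otimes> Y) = q \<odot> (sig j x \<otimes> Y)"
proof -
  note c = s_closed[OF i] s_closed[OF j] k_closed[OF j]
  have "s i \<otimes> sig j x = sig j x \<otimes> s i"
    using c by (simp add: sig_def l_distr r_distr smult_mult mult_smult comm_s[OF i j ij] comm_s_k[OF i j ij])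
  then have "s i \<otimes> (sig j x \<otimes> Y) = sig j x \<otimes> (s i \<otimes> Y)"
    using c(1) sig_closed[OF j] Y(1) by (metis m_assoc)
  then show ?thesis using Y sig_closed[OF j] by (simp add: mult_smult)
qed

text \<open>The only consequence of the Yang--Baxter equation that is needed.  The six vectors in the proof
  span the module generated by \<open>Y\<close> over the algebra of \<open>s i\<close> and \<open>s (Suc i)\<close>.\<close>

lemma s_Suc_sig_sig:
  assumes i: "i \<in> {1..<n}" and Y: "Y \<in> carrier A" "s i \<otimes> Y = q \<odot> Y"
    and x: "x = q ^ i" and y: "y = q ^ Suc i"
  shows "s (Suc i) \<otimes> (sig i x \<otimes> (sig (Suc i) y \<otimes> Y)) = q \<odot> (sig i x \<otimes> (sig (Suc i) y \<otimes> Y))"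
proof -
  define t l where "t = s (Suc i)" and "l = k (Suc i)"
  have i1: "i \<in> {1..n}" and i2: "Suc i \<in> {1..n}" using i by auto
  have c: "s i \<in> carrier A" "k i \<in> carrier A" "t \<in> carrier A" "l \<in> carrier A" "r i \<in> carrier A"
    using s_closed[OF i1] k_closed[OF i1] s_closed[OF i2] k_closed[OF i2] r_closed[OF i1]
    by (simp_all add: t_def l_def)
  define V where "V = combo Y (t \<otimes> Y) (l \<otimes> Y) (s i \<otimes> (t \<otimes> Y)) (s i \<otimes> (l \<otimes> Y)) (k i \<otimes> (t \<otimes> Y))"
  have V_closed: "V a1 a2 a3 a4 a5 a6 \<in> carrier A" for a1 a2 a3 a4 a5 a6
    unfolding V_def using c Y by (intro combo_simps) auto
  have V_add: "V a1 a2 a3 a4 a5 a6 \<oplus> V b1 b2 b3 b4 b5 b6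
      = V (a1 + b1) (a2 + b2) (a3 + b3) (a4 + b4) (a5 + b5) (a6 + b6)"
    for a1 a2 a3 a4 a5 a6 b1 b2 b3 b4 b5 b6
    unfolding V_def using c Y by (intro combo_simps) auto
  have V_smult: "d \<odot> V a1 a2 a3 a4 a5 a6 = V (d * a1) (d * a2) (d * a3) (d * a4) (d * a5) (d * a6)"
    for d a1 a2 a3 a4 a5 a6
    unfolding V_def using c Y by (intro combo_simps) auto
  have kY: "k i \<otimes> Y = \<zero>" using k_eigen[OF i1 Y] .
  \<comment> \<open>This is why \<open>k i \<otimes> (l \<otimes> Y)\<close> is absent from the six
    vectors: it is a multiple of the last one.\<close>
  have klY: "k i \<otimes> (l \<otimes> Y) = q \<odot> (k i \<otimes> (t \<otimes> Y))"
  proof -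
    have "k i \<otimes> (l \<otimes> Y) = (k i \<otimes> (t \<otimes> s i)) \<otimes> Y"
      using c Y kts[OF i] by (simp add: m_assoc t_def l_def)
    then show ?thesis using c Y by (simp add: m_assoc mult_smult)
  qed
  have ttY: "t \<otimes> (t \<otimes> Y) = V 1 z (- z * \<nu>) 0 0 0"
    using c Y quad[OF i2] unfolding V_def
    by (simp add: m_assoc[symmetric] l_distr smult_mult combo_def a_ac flip: t_def l_def)
  have tlY: "t \<otimes> (l \<otimes> Y) = V 0 0 \<nu> 0 0 0"
    using c Y s_k[OF i2] unfolding V_def
    by (simp add: m_assoc[symmetric] smult_mult combo_def flip: t_def l_def)
  have tstY: "t \<otimes> (s i \<otimes> (t \<otimes> Y)) = V 0 0 0 q 0 0"
  proof -
    have "t \<otimes> (s i \<otimes> (t \<otimes> Y)) = (s i \<otimes> (t \<otimes> s i)) \<otimes> Y"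
      using c Y braid_s[OF i] by (simp add: m_assoc t_def)
    then show ?thesis using c Y unfolding V_def by (simp add: m_assoc mult_smult combo_def)
  qed
  have tslY: "t \<otimes> (s i \<otimes> (l \<otimes> Y)) = V 0 0 0 0 0 q"
  proof -
    have "t \<otimes> (s i \<otimes> (l \<otimes> Y)) = (t \<otimes> (s i \<otimes> l)) \<otimes> Y" using c Y by (simp add: m_assoc)
    also have "\<dots> = k i \<otimes> (l \<otimes> Y)" using c Y tsl[OF i] by (simp add: m_assoc t_def l_def)
    finally show ?thesis using c Y unfolding V_def klY by (simp add: combo_def)
  qed
  \<comment> \<open>The relation \<open>stkts\<close> knows this vector only after
    \<open>s i\<close> has been applied, and with a factor \<open>s i\<close> in front of
    \<open>Y\<close>, which costs a factor \<open>q\<close>. Multiplying by \<open>r i\<close>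
    removes the left \<open>s i\<close>, and \<open>r_eq\<close> expands \<open>r i\<close>
    again.\<close>
  have tktY: "t \<otimes> (k i \<otimes> (t \<otimes> Y)) = V 0 0 (- z * inverse q) 0 (inverse q) z"
  proof -
    have "q \<odot> (s i \<otimes> (t \<otimes> (k i \<otimes> (t \<otimes> Y)))) = (s i \<otimes> (t \<otimes> (k i \<otimes> (t \<otimes> s i)))) \<otimes> Y"
      using c Y by (simp add: m_assoc mult_smult)
    also have "\<dots> = l \<otimes> Y" using stkts[OF i] by (simp add: t_def l_def)
    finally have "s i \<otimes> (t \<otimes> (k i \<otimes> (t \<otimes> Y))) = inverse q \<odot> (l \<otimes> Y)"
      using c Y q_nz by (simp add: smult_eq_iff)
    then have "r i \<otimes> (s i \<otimes> (t \<otimes> (k i \<otimes> (t \<otimes> Y)))) = inverse q \<odot> (r i \<otimes> (l \<otimes> Y))"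
      using c Y by (simp add: mult_smult)
    then have "t \<otimes> (k i \<otimes> (t \<otimes> Y)) = inverse q \<odot> (r i \<otimes> (l \<otimes> Y))"
      using c Y r_s[OF i1] by (simp add: m_assoc[of "r i" "s i", symmetric])
    also have "r i \<otimes> (l \<otimes> Y) = s i \<otimes> (l \<otimes> Y) \<oplus> (- z) \<odot> (l \<otimes> Y) \<oplus> z \<odot> (k i \<otimes> (l \<otimes> Y))"
      unfolding r_eq[OF i1] using c Y by (simp add: l_distr smult_mult)
    also have "\<dots> = V 0 0 (- z) 0 1 (z * q)"
      unfolding klY V_def using c Y by (simp add: combo_def smult_smult a_ac)
    also have "inverse q \<odot> \<dots> = V 0 0 (- z * inverse q) 0 (inverse q) z"
      using q_nz by (simp add: V_smult field_simps)
    finally show ?thesis .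
  qed
  have tV: "t \<otimes> V a1 a2 a3 a4 a5 a6 = V a2 (a1 + z * a2) (- z * \<nu> * a2 + \<nu> * a3 - z * inverse q * a6)
      (q * a4) (inverse q * a6) (q * a5 + z * a6)" for a1 a2 a3 a4 a5 a6
  proof -
    have "t \<otimes> V a1 a2 a3 a4 a5 a6 = V 0 a1 0 0 0 0 \<oplus> (a2 \<odot> (t \<otimes> (t \<otimes> Y)) \<oplus> (a3 \<odot> (t \<otimes> (l \<otimes> Y))
      \<oplus> (a4 \<odot> (t \<otimes> (s i \<otimes> (t \<otimes> Y))) \<oplus> (a5 \<odot> (t \<otimes> (s i \<otimes> (l \<otimes> Y))) \<oplus> a6 \<odot> (t \<otimes> (k i \<otimes> (t \<otimes> Y)))))))"
      unfolding V_def using c Y by (simp add: combo_def r_distr mult_smult)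
    then show ?thesis
      unfolding ttY tlY tstY tslY tktY V_smult V_add by (simp add: algebra_simps)
  qed
  define a where "a = (x\<^sup>2 - 1) / z"
  define a' where "a' = (y\<^sup>2 - 1) / z"
  have inner: "sig (Suc i) y \<otimes> Y = inverse y \<odot> V 1 a' (\<beta> y) 0 0 0"
    unfolding sig_mult[OF i2 Y(1)] V_def using c Y by (simp add: combo_def a'_def t_def l_def a_ac)
  have outer: "sig i x \<otimes> V 1 a' (\<beta> y) 0 0 0 = inverse x \<odot>
      V (1 + a * q) a' (\<beta> y) (a * a') (a * \<beta> y) (\<beta> x * a' + q * \<beta> x * \<beta> y)"
  proof -
    have "s i \<otimes> V 1 a' (\<beta> y) 0 0 0 = V q 0 0 a' (\<beta> y) 0"
      unfolding V_def using c Y by (simp add: combo_def r_distr mult_smult)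
    moreover have "k i \<otimes> V 1 a' (\<beta> y) 0 0 0 = V 0 0 0 0 0 (a' + q * \<beta> y)"
      unfolding V_def using c Y
      by (simp add: combo_def r_distr mult_smult kY klY smult_smult smult_l_distr mult.commute)
    ultimately show ?thesis
      by (simp add: sig_mult[OF i1 V_closed] a_def[symmetric] V_smult V_add algebra_simps)
  qed
  have yx: "y = q * x" using x y by simp
  \<comment> \<open>From here on, one scalar identity per coordinate of
    \<open>t \<otimes> V = q \<odot> V\<close>; agreement of coordinates suffices even if the six
    vectors are dependent. The fourth coordinate is automatic, since \<open>tV\<close> multiplies it
    by \<open>q\<close>.\<close>
  have e1: "a' = q * (1 + a * q)"
    using z_nz q_nz by (simp add: a_def a'_def yx z field_simps power2_eq_square)
  have qz: "q * q = 1 + q * z" using q_nz by (simp add: z field_simps)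
  have e2: "1 + a * q + z * a' = q * a'"
  proof -
    have "q * (1 + a * q + z * a') = q * (q * a')"
      using e1 qz by (metis (no_types, opaque_lifting) distrib_left distrib_right mult.assoc mult_1)
    then show ?thesis using q_nz by simp
  qed
  \<comment> \<open>The fifth coordinate of the image is \<open>inverse q\<close> times the old
    sixth and must be \<open>q\<close> times the old fifth, so the sixth has to be
    \<open>q\<^sup>2\<close> times the fifth. This is the origin of
    \<open>\<beta>_rec\<close>.\<close>
  have e3: "\<beta> x * a' + q * \<beta> x * \<beta> y = q\<^sup>2 * a * \<beta> y"
    using \<beta>_rec[OF i x y] by (simp add: a_def a'_def)
  \<comment> \<open>The third coordinate; it is what the assumption \<open>\<beta>_lin\<close> is
    made for.\<close>
  have e4: "- z * \<nu> * a' + \<nu> * \<beta> y - z * inverse q * (q\<^sup>2 * a * \<beta> y) = q * \<beta> y"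
  proof -
    have za: "z * a' = y\<^sup>2 - 1" "z * a = x\<^sup>2 - 1" using z_nz by (simp_all add: a_def a'_def)
    have "- z * \<nu> * a' + \<nu> * \<beta> y - z * inverse q * (q\<^sup>2 * a * \<beta> y)
        = \<nu> * (\<beta> y - z * a') - q * \<beta> y * (z * a)"
      using q_nz by (simp add: power2_eq_square field_simps)
    also have "\<dots> = q * \<beta> y"
      unfolding za using \<beta>_lin[OF i x y] by (simp add: algebra_simps)
    finally show ?thesis .
  qed
  have e6: "inverse q * (q\<^sup>2 * a * \<beta> y) = q * (a * \<beta> y)"
    using q_nz by (simp add: power2_eq_square field_simps)
  have e5: "q * (a * \<beta> y) + z * (q\<^sup>2 * a * \<beta> y) = q * (q\<^sup>2 * a * \<beta> y)"
  proof -
    have "q * (a * \<beta> y) + z * (q\<^sup>2 * a * \<beta> y) = (1 + q * z) * (q * (a * \<beta> y))"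
      by (simp add: power2_eq_square algebra_simps)
    then show ?thesis by (simp add: power2_eq_square flip: qz)
  qed
  have "t \<otimes> V (1 + a * q) a' (\<beta> y) (a * a') (a * \<beta> y) (\<beta> x * a' + q * \<beta> x * \<beta> y)
      = q \<odot> V (1 + a * q) a' (\<beta> y) (a * a') (a * \<beta> y) (\<beta> x * a' + q * \<beta> x * \<beta> y)"
    unfolding e3 tV V_smult e4 e5 e2 e6 by (simp add: e1[symmetric])
  then show ?thesis
    using c sig_closed[OF i1] V_closed
    by (simp add: inner outer mult_smult smult_smult mult.commute mult.left_commute flip: t_def)
qed

section \<open>Ordered products of Baxterized elements and powers of the 1-shuffle\<close>

definition sigs :: "nat list \<Rightarrow> 'a \<Rightarrow> 'a" where
  "sigs js Y = foldr (\<lambda>i a. sig i (q ^ i) \<otimes> a) js Y"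

lemma sigs_closed: "set js \<subseteq> {1..n} \<Longrightarrow> Y \<in> carrier A \<Longrightarrow> sigs js Y \<in> carrier A"
  by (induction js) (auto simp: sigs_def sig_closed)

lemma sigs_append: "sigs (js @ js') Y = sigs js (sigs js' Y)"
  by (simp add: sigs_def)

lemma sigs_Cons: "sigs (j # js) Y = sig j (q ^ j) \<otimes> sigs js Y"
  by (simp add: sigs_def)

lemma s_sigs_comm:
  assumes "i \<in> {1..n}" "set js \<subseteq> {1..n}" "\<forall>j\<in>set js. \<bar>int i - int j\<bar> > 1"
    and "Y \<in> carrier A" "s i \<otimes> Y = q \<odot> Y"
  shows "s i \<otimes> sigs js Y = q \<odot> sigs js Y"
  using assms(2,3)
proof (induction js)
  case Nil
  then show ?case using assms by (simp add: sigs_def)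
next
  case (Cons j js)
  then show ?case using assms by (simp add: sigs_Cons s_sig_comm sigs_closed)
qed

text \<open>The leftmost factor \<open>sig 1 q\<close> alone produces the eigenvalue, so
  \<open>Y\<close> may be arbitrary; this supplies the new index in each induction step.\<close>

lemma s_one_sigs:
  assumes "1 \<le> n" "Y \<in> carrier A"
  shows "s 1 \<otimes> sigs [1..<Suc n] Y = q \<odot> sigs [1..<Suc n] Y"
proof -
  have "[1..<Suc n] = 1 # [2..<Suc n]" using assms(1) by (simp add: upt_conv_Cons numeral_2_eq_2)
  then show ?thesis
    using s_sig_q[of 1 "sigs [2..<Suc n] Y"] sigs_closed[of "[2..<Suc n]" Y] assms
    by (simp add: sigs_Cons subset_iff del: upt_Suc)
qed

text \<open>Cut the product at \<open>i\<close>: the tail with indices from \<open>i + 2\<close> on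
  lets \<open>s i\<close> pass, the middle pair turns the eigenvector of \<open>s i\<close> into one
  of \<open>s (Suc i)\<close>, and the head with indices below \<open>i\<close> lets
  \<open>s (Suc i)\<close> pass.\<close>

lemma s_Suc_sigs:
  assumes i: "i \<in> {1..<n}" and Y: "Y \<in> carrier A" "s i \<otimes> Y = q \<odot> Y"
  shows "s (Suc i) \<otimes> sigs [1..<Suc n] Y = q \<odot> sigs [1..<Suc n] Y"
proof -
  let ?W = "sigs [i + 2..<Suc n] Y"
  have split: "[1..<Suc n] = [1..<i] @ [i, Suc i] @ [i + 2..<Suc n]"
  proof -
    have "[1..<Suc n] = [1..<i] @ [i..<Suc n]"
      using i upt_add_eq_append[of 1 i "Suc n - i"] by simp
    also have "[i..<Suc n] = i # Suc i # [i + 2..<Suc n]"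
      using i by (simp add: upt_conv_Cons)
    finally show ?thesis by simp
  qed
  have W: "?W \<in> carrier A" "s i \<otimes> ?W = q \<odot> ?W"
    using i Y by (auto intro!: sigs_closed s_sigs_comm)
  have "s (Suc i) \<otimes> sigs [i, Suc i] ?W = q \<odot> sigs [i, Suc i] ?W"
    using s_Suc_sig_sig[OF i W HOL.refl HOL.refl] by (simp add: sigs_def)
  then show ?thesis
    unfolding split sigs_append using i W(1)
    by (intro s_sigs_comm[of "Suc i" "[1..<i]"] sigs_closed[of "[i, Suc i]"]) auto
qed

definition Sh :: 'a where
  "Sh = inverse (qfact q (n + 1)) \<odot> shuffle1 A q sig n"

lemma shuffle1_eq_sigs: "shuffle1 A q sig n = sigs [1..<Suc n] \<one>"
  by (simp add: shuffle1_def sigs_def)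

lemma sigs_mult:
  "set js \<subseteq> {1..n} \<Longrightarrow> X \<in> carrier A \<Longrightarrow> Y \<in> carrier A \<Longrightarrow> sigs js X \<otimes> Y = sigs js (X \<otimes> Y)"
  by (induction js) (simp_all add: sigs_def[of "[]"] sigs_Cons sig_closed sigs_closed m_assoc)

lemma shuffle1_closed: "shuffle1 A q sig n \<in> carrier A"
  unfolding shuffle1_eq_sigs by (rule sigs_closed) auto

lemma Sh_closed [simp]: "Sh \<in> carrier A"
  by (simp add: Sh_def shuffle1_closed)

lemma Sh_mult: "Y \<in> carrier A \<Longrightarrow> Sh \<otimes> Y = inverse (qfact q (n + 1)) \<odot> sigs [1..<Suc n] Y"
  using sigs_mult[of "[1..<Suc n]" \<one> Y] shuffle1_closed
  unfolding Sh_def shuffle1_eq_sigs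
  by (simp add: smult_mult subset_iff del: upt_Suc)

text \<open>For \<open>j = 0\<close> the index range is empty, so the induction starts from
  \<open>\<one>\<close> without any information; each factor then gains one generator, and
  \<open>n\<close> factors reach all of them.\<close>

lemma s_Sh_pow:
  "j \<le> n \<Longrightarrow> i \<in> {1..j} \<Longrightarrow> s i \<otimes> Sh [^] j = q \<odot> Sh [^] j"
proof (induction j arbitrary: i)
  case (Suc j)
  let ?c = "inverse (qfact q (n + 1))"
  let ?X = "Sh [^] j"
  have X: "?X \<in> carrier A" by simp
  have G: "sigs [1..<Suc n] ?X \<in> carrier A" by (rule sigs_closed) auto
  have "s i \<otimes> sigs [1..<Suc n] ?X = q \<odot> sigs [1..<Suc n] ?X"
  proof (cases "i = 1")
    case True
    then show ?thesis using s_one_sigs[OF _ X] Suc.prems by simp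
  next
    case False
    \<comment> \<open>The eigenvalue at \<open>Suc m\<close> comes from the one at \<open>m\<close>,
      which the induction hypothesis covers; \<open>m < n\<close> because
      \<open>Suc m \<le> Suc j \<le> n\<close>.\<close>
    then obtain m where m: "i = Suc m" "m \<in> {1..j}" "m \<in> {1..<n}"
      using Suc.prems by (cases i) auto
    then show ?thesis using s_Suc_sigs[OF m(3) X] Suc.IH[of m] Suc.prems by simp
  qed
  then have "s i \<otimes> (?c \<odot> sigs [1..<Suc n] ?X) = q \<odot> (?c \<odot> sigs [1..<Suc n] ?X)"
    using G Suc.prems by (simp add: mult_smult s_closed smult_smult mult.commute del: upt_Suc)
  moreover have "Sh [^] Suc j = ?c \<odot> sigs [1..<Suc n] ?X"
    using Sh_mult[OF X] nat_pow_Suc2[OF Sh_closed, of j] by simp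
  ultimately show ?case by simp
qed simp

lemma \<chi>_sigs:
  "set js \<subseteq> {1..n} \<Longrightarrow> \<chi> (sigs js \<one>) = prod_list (map (\<lambda>i. qnum q (Suc i)) js)"
  by (induction js) (simp_all add: sigs_def[of "[]"] sigs_Cons \<chi>_one \<chi>_mult \<chi>_sig sig_closed sigs_closed)

lemma \<chi>_Sh: "\<chi> Sh = 1"
proof -
  have "prod_list (map (\<lambda>i. qnum q (Suc i)) [1..<Suc n]) = (\<Prod>i = 1..n. qnum q (Suc i))"
    using prod.distinct_set_conv_list[of "[1..<Suc n]" "\<lambda>i. qnum q (Suc i)"]
    by (simp add: atLeastLessThanSuc_atLeastAtMost del: upt_Suc)
  also have "\<dots> = (\<Prod>i = Suc 1..Suc n. qnum q i)"
    by (simp only: prod.shift_bounds_cl_Suc_ivl)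
  also have "\<dots> = qfact q (n + 1)"
  proof -
    have "q - inverse q \<noteq> 0" using z_nz z by simp
    \<comment> \<open>The shuffle contributes only the quantum numbers from 2 to
      \<open>n + 1\<close>; the first factor of the factorial is 1.\<close>
    then have "qnum q 1 = 1" by (simp add: qnum_def)
    then show ?thesis using prod.atLeast_Suc_atMost[of 1 "Suc n" "qnum q"] by (simp add: qfact_def del: prod.cl_ivl_Suc)
  qed
  finally have "\<chi> (shuffle1 A q sig n) = qfact q (n + 1)"
    unfolding shuffle1_eq_sigs using \<chi>_sigs[of "[1..<Suc n]"] by (simp add: subset_iff del: upt_Suc)
  then show ?thesis
    using qfact_nz by (simp add: Sh_def \<chi>_smult shuffle1_closed del: One_nat_def)
qed

lemma \<chi>_Sh_pow: "\<chi> (Sh [^] (j::nat)) = 1"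
  by (induction j) (simp_all add: \<chi>_one \<chi>_mult \<chi>_Sh)

text \<open>Reversal exchanges \<open>kts\<close> with \<open>stk\<close>, \<open>tsl\<close> with
  \<open>lst\<close> and \<open>s_k\<close> with \<open>k_s\<close>, while \<open>stkts\<close> is a
  palindrome up to bracketing.\<close>

lemma baxter_system_opposite: "baxter_system (opposite A) q n s r \<chi> k \<nu> z \<beta>"
proof (intro baxter_system.intro baxter_system_axioms.intro braid_system_opposite)
  show "s i \<otimes>\<^bsub>opposite A\<^esub> (s (Suc i) \<otimes>\<^bsub>opposite A\<^esub> (k i \<otimes>\<^bsub>opposite A\<^esub>
      (s (Suc i) \<otimes>\<^bsub>opposite A\<^esub> s i))) = k (Suc i)" if "i \<in> {1..<n}" for i
    using stkts[OF that] that by (simp add: m_assoc s_closed k_closed)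
qed (use z \<nu>_q k_closed quad s_k k_s comm_s_k r_eq kts tsl stk lst \<beta>_q \<beta>_rec \<beta>_lin
    s_closed in \<open>auto simp: m_assoc\<close>)

theorem is_symmetrizer_Sh_pow: "is_symmetrizer A q s n (Sh [^] n)"
proof -
  \<comment> \<open>Read in \<open>A\<close>, \<open>op.Sh\<close> is the normalised product
    \<sigma>_n(q^n) ... \<sigma>_1(q); its power is the right eigenvector.\<close>
  interpret op: baxter_system "opposite A" q n s r \<chi> k \<nu> z \<beta> by (rule baxter_system_opposite)
  show ?thesis
  proof (rule is_symmetrizer_of_eigen)
    show "op.Sh [^]\<^bsub>opposite A\<^esub> n \<in> carrier A"
      using op.nat_pow_closed[OF op.Sh_closed] by simp
    show "(op.Sh [^]\<^bsub>opposite A\<^esub> n) \<otimes> s i = q \<odot> (op.Sh [^]\<^bsub>opposite A\<^esub> n)" if "i \<in> {1..n}" for i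
      using op.s_Sh_pow[of n i] that by simp
  qed (use s_Sh_pow \<chi>_Sh_pow op.\<chi>_Sh_pow in auto)
qed

corollary symmetrizer_eq_shuffle_pow:
  "(\<exists>!S. is_symmetrizer A q s n S) \<and>
    symmetrizer A q s n = (inverse (qfact q (n + 1)) \<odot> shuffle1 A q sig n) [^] n"
  using is_symmetrizer_Sh_pow is_symmetrizer_unique unfolding symmetrizer_def Sh_def
  by (metis the_equality)

end

subsection \<open>The braid group and group algebras\<close>

lemma braid_rel_words:
  "(u, v) \<in> braid_rel n \<Longrightarrow> u \<in> braid_words n \<and> v \<in> braid_words n"
  by (induction rule: braid_rel.induct) (auto simp: braid_words_def)

lemma equiv_braid_rel: "equiv (braid_words n) (braid_rel n)"
proof (intro equivI)
  show "trans (braid_rel n)" by (rule transI) (rule braid_rel.trans)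
  show "sym (braid_rel n)" by (rule symI) (rule braid_rel.sym)
qed (use braid_rel_words in \<open>auto intro: refl_onI braid_rel.refl\<close>)

definition braid_class :: "nat \<Rightarrow> braid_word \<Rightarrow> braid_word set" where
  "braid_class n u = braid_rel n `` {u}"

lemma braid_class_eq: "(u, v) \<in> braid_rel n \<Longrightarrow> braid_class n u = braid_class n v"
  using equiv_class_eq[OF equiv_braid_rel] by (simp add: braid_class_def)

lemma carrier_braid_group: "carrier (braid_group n) = braid_class n ` braid_words n"
  by (auto simp: braid_group_def quotient_def braid_class_def)

lemma braid_class_closed: "u \<in> braid_words n \<Longrightarrow> braid_class n u \<in> carrier (braid_group n)"
  by (auto simp: carrier_braid_group)

text \<open>The group multiplies classes by saturating the set of all concatenations; by
  \<open>append\<close> these concatenations are all equivalent to \<open>u @ v\<close>.\<close>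

lemma mult_braid_class:
  assumes "u \<in> braid_words n" "v \<in> braid_words n"
  shows "braid_class n u \<otimes>\<^bsub>braid_group n\<^esub> braid_class n v = braid_class n (u @ v)"
proof -
  have "(u @ v, w) \<in> braid_rel n"
    if "(u, u') \<in> braid_rel n" "(v, v') \<in> braid_rel n" "(u' @ v', w) \<in> braid_rel n" for u' v' w
    using that by (meson braid_rel.append braid_rel.trans)
  moreover have "(u, u) \<in> braid_rel n" "(v, v) \<in> braid_rel n"
    using assms by (auto intro: braid_rel.refl)
  ultimately have "braid_rel n `` {u' @ v' |u' v'. (u, u') \<in> braid_rel n \<and> (v, v') \<in> braid_rel n}
      = braid_rel n `` {u @ v}"
    by blast
  then show ?thesis by (simp add: braid_group_def braid_class_def)
qed

lemma one_braid_group: "\<one>\<^bsub>braid_group n\<^esub> = braid_class n []"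
  by (simp add: braid_group_def braid_class_def)

lemma monoid_braid_group: "monoid (braid_group n)"
proof -
  have "u @ v \<in> braid_words n" if "u \<in> braid_words n" "v \<in> braid_words n" for u v
    using that by (auto simp: braid_words_def)
  moreover have "[] \<in> braid_words n" by (simp add: braid_words_def)
  ultimately show ?thesis
    by (intro monoidI) (auto simp: carrier_braid_group one_braid_group mult_braid_class)
qed

section \<open>The weight of braid words and classes\<close>

definition word_weight :: "'k::field \<Rightarrow> braid_word \<Rightarrow> 'k" where
  "word_weight q u = prod_list (map (\<lambda>(i, b). if b then q else inverse q) u)"

lemma word_weight_append: "word_weight q (u @ v) = word_weight q u * word_weight q v"
  by (simp add: word_weight_def)

text \<open>The target is commutative and both sides of a braid or commutation relation have equally
  many letters, so only \<open>cancel\<close> is a condition, and it holds because \<open>q\<close>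
  is invertible.\<close>

lemma word_weight_braid_rel:
  assumes "q \<noteq> 0" "(u, v) \<in> braid_rel n"
  shows "word_weight q u = word_weight q v"
  using assms(2)
proof (induction rule: braid_rel.induct)
  case (cancel i b)
  then show ?case using assms(1) by (cases b) (simp_all add: word_weight_def)
qed (simp_all add: word_weight_append, simp_all add: word_weight_def)

text \<open>On the class of a word the weight is constant, so the image is a singleton and
  \<open>the_elem\<close> returns the common value.\<close>

definition class_weight :: "'k::field \<Rightarrow> braid_word set \<Rightarrow> 'k" where
  "class_weight q U = the_elem (word_weight q ` U)"

lemma class_weight_braid_class:
  assumes "q \<noteq> 0" "u \<in> braid_words n"
  shows "class_weight q (braid_class n u) = word_weight q u"
proof -
  have "word_weight q ` braid_class n u = {word_weight q u}"
  proof (rule equalityI; rule subsetI)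
    fix x assume "x \<in> word_weight q ` braid_class n u"
    then obtain v where "x = word_weight q v" "(u, v) \<in> braid_rel n"
      by (auto simp: braid_class_def)
    then show "x \<in> {word_weight q u}"
      using word_weight_braid_rel[OF assms(1)] by auto
  next
    have "u \<in> braid_class n u"
      using assms braid_rel.refl[of u n] by (simp add: braid_class_def)
    then show "x \<in> word_weight q ` braid_class n u" if "x \<in> {word_weight q u}" for x
      using that by blast
  qed
  then show ?thesis by (simp add: class_weight_def)
qed

text \<open>Reduces linear identities to \<open>single\<close>; the set \<open>C\<close> keeps the
  induction inside the carrier, where the monoid laws are available.\<close>

lemma poly_mapping_single_induct [consumes 1, case_names zero add]:
  assumes "Poly_Mapping.keys (f :: 'g \<Rightarrow>\<^sub>0 'k::comm_monoid_add) \<subseteq> C" and "P 0"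
    and step: "\<And>f x c. x \<in> C \<Longrightarrow> Poly_Mapping.keys f \<subseteq> C \<Longrightarrow> P f \<Longrightarrow> P (Poly_Mapping.single x c + f)"
  shows "P f"
proof -
  have f: "(\<Sum>x\<in>Poly_Mapping.keys f. Poly_Mapping.single x (Poly_Mapping.lookup f x)) = f"
    by (rule poly_mapping_eqI)
      (auto simp: lookup_sum lookup_single when_def in_keys_iff)
  \<comment> \<open>The support condition is carried along because \<open>step\<close> asks for it
    for the partial sum.\<close>
  have "P (\<Sum>x\<in>X. Poly_Mapping.single x (Poly_Mapping.lookup f x)) \<and>
    Poly_Mapping.keys (\<Sum>x\<in>X. Poly_Mapping.single x (Poly_Mapping.lookup f x)) \<subseteq> C"
    if "finite X" "X \<subseteq> C" for X
    using that
  proof (induction X)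
    case empty
    then show ?case using assms(2) by simp
  next
    case (insert x X)
    let ?t = "Poly_Mapping.single x (Poly_Mapping.lookup f x)"
    let ?S = "\<Sum>x\<in>X. Poly_Mapping.single x (Poly_Mapping.lookup f x)"
    have S: "P ?S" "Poly_Mapping.keys ?S \<subseteq> C" and x: "x \<in> C" using insert by auto
    have "Poly_Mapping.keys (?t + ?S) \<subseteq> Poly_Mapping.keys ?t \<union> Poly_Mapping.keys ?S"
      by (rule keys_add)
    also have "\<dots> \<subseteq> C" using S x by auto
    finally show ?case using step[OF x S(2,1)] insert.hyps by simp
  qed
  from this[OF finite_keys assms(1)] show ?thesis unfolding f by simp
qed

section \<open>Convolution and scaling of finitely supported functions\<close>

definition convolution :: "('g \<Rightarrow> 'g \<Rightarrow> 'g) \<Rightarrow> ('g \<Rightarrow>\<^sub>0 'k::field) \<Rightarrow> ('g \<Rightarrow>\<^sub>0 'k) \<Rightarrow> ('g \<Rightarrow>\<^sub>0 'k)" where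
  "convolution m f g = (\<Sum>x\<in>Poly_Mapping.keys f. \<Sum>y\<in>Poly_Mapping.keys g.
       Poly_Mapping.single (m x y) (Poly_Mapping.lookup f x * Poly_Mapping.lookup g y))"

lemma convolution_zero [simp]: "convolution m 0 g = 0" "convolution m f 0 = 0"
  by (simp_all add: convolution_def)

lemma convolution_add_left: "convolution m (f + f') g = convolution m f g + convolution m f' g"
  unfolding convolution_def
  by (rule setsum_keys_plus_distrib) (simp_all add: distrib_right single_add sum.distrib)

lemma convolution_add_right: "convolution m f (g + g') = convolution m f g + convolution m f g'"
proof -
  have "(\<Sum>y\<in>Poly_Mapping.keys (g + g'). Poly_Mapping.single (m x y) (c * Poly_Mapping.lookup (g + g') y))
     = (\<Sum>y\<in>Poly_Mapping.keys g. Poly_Mapping.single (m x y) (c * Poly_Mapping.lookup g y))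
     + (\<Sum>y\<in>Poly_Mapping.keys g'. Poly_Mapping.single (m x y) (c * Poly_Mapping.lookup g' y))" for x c
    by (rule setsum_keys_plus_distrib) (simp_all add: distrib_left single_add)
  then show ?thesis by (simp add: convolution_def sum.distrib)
qed

lemma convolution_single:
  "convolution m (Poly_Mapping.single x c) (Poly_Mapping.single y d) = Poly_Mapping.single (m x y) (c * d)"
  by (auto simp: convolution_def)

definition scale :: "'k::field \<Rightarrow> ('g \<Rightarrow>\<^sub>0 'k) \<Rightarrow> ('g \<Rightarrow>\<^sub>0 'k)" where
  "scale c = Poly_Mapping.map ((*) c)"

lemma lookup_scale: "Poly_Mapping.lookup (scale c f) x = c * Poly_Mapping.lookup f x"
  unfolding scale_def by transfer (simp add: when_def)

lemma keys_scale: "Poly_Mapping.keys (scale c f) \<subseteq> Poly_Mapping.keys f"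
  by (auto simp: in_keys_iff lookup_scale)

lemma scale_simps:
  "scale c (f + g) = scale c f + scale c g" "scale (c + d) f = scale c f + scale d f"
  "scale c (scale d f) = scale (c * d) f" "scale 1 f = f" "scale c 0 = 0"
  "scale c (Poly_Mapping.single x d) = Poly_Mapping.single x (c * d)"
  by (rule poly_mapping_eqI; simp add: lookup_scale lookup_add lookup_single when_def algebra_simps)+

context
  fixes G :: "('g, 'm) monoid_scheme" (structure)
  assumes G: "monoid G"
begin

interpretation G: monoid G by (rule G)

lemma keys_convolution:
  assumes "Poly_Mapping.keys f \<subseteq> carrier G" "Poly_Mapping.keys g \<subseteq> carrier G"
  shows "Poly_Mapping.keys (convolution (\<otimes>) f g) \<subseteq> carrier G"
proof -
  have "Poly_Mapping.keys (convolution (\<otimes>) f g) \<subseteq> (\<Union>x\<in>Poly_Mapping.keys f. \<Union>y\<in>Poly_Mapping.keys g. {x \<otimes> y})"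
    unfolding convolution_def
    by (intro order.trans[OF keys_sum] UN_mono) auto
  then show ?thesis using assms by auto
qed

text \<open>By trilinearity, three nested inductions reduce the claim to associativity in
  \<open>G\<close>.\<close>

lemma convolution_assoc:
  assumes "Poly_Mapping.keys f \<subseteq> carrier G" "Poly_Mapping.keys g \<subseteq> carrier G" "Poly_Mapping.keys h \<subseteq> carrier G"
  shows "convolution (\<otimes>) (convolution (\<otimes>) f g) h = convolution (\<otimes>) f (convolution (\<otimes>) g h)"
  using assms(1)
proof (induction rule: poly_mapping_single_induct)
  case (add f x c)
  have "convolution (\<otimes>) (convolution (\<otimes>) (Poly_Mapping.single x c) g) h =
    convolution (\<otimes>) (Poly_Mapping.single x c) (convolution (\<otimes>) g h)"
    using assms(2)
  proof (induction rule: poly_mapping_single_induct)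
    case (add g y d)
    have "convolution (\<otimes>) (convolution (\<otimes>) (Poly_Mapping.single x c) (Poly_Mapping.single y d)) h =
      convolution (\<otimes>) (Poly_Mapping.single x c) (convolution (\<otimes>) (Poly_Mapping.single y d) h)"
      using assms(3)
      by (induction rule: poly_mapping_single_induct)
        (use add.hyps \<open>x \<in> carrier G\<close> in
          \<open>simp_all add: convolution_add_right convolution_single G.m_assoc mult.assoc\<close>)
    then show ?case using add by (simp add: convolution_add_left convolution_add_right)
  qed simp
  then show ?case using add by (simp add: convolution_add_left)
qed simp

lemma convolution_one:
  assumes "Poly_Mapping.keys f \<subseteq> carrier G"
  shows "convolution (\<otimes>) (Poly_Mapping.single \<one> 1) f = f"
    and "convolution (\<otimes>) f (Poly_Mapping.single \<one> 1) = f"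
  using assms
  by (induction rule: poly_mapping_single_induct)
    (simp_all add: convolution_add_left convolution_add_right convolution_single)

lemma convolution_scale_left: "convolution (\<otimes>) (scale c f) g = scale c (convolution (\<otimes>) f g)"
proof -
  have "Poly_Mapping.keys f \<subseteq> UNIV" "Poly_Mapping.keys g \<subseteq> UNIV" by auto
  then show ?thesis
  proof (induction rule: poly_mapping_single_induct)
    case (add f x d)
    have "convolution (\<otimes>) (scale c (Poly_Mapping.single x d)) g
        = scale c (convolution (\<otimes>) (Poly_Mapping.single x d) g)"
      using \<open>Poly_Mapping.keys g \<subseteq> UNIV\<close>
      by (induction rule: poly_mapping_single_induct)
        (simp_all add: convolution_add_right convolution_single scale_simps mult.assoc)
    then show ?case using add by (simp add: convolution_add_left scale_simps)
  qed (simp add: scale_simps)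
qed

lemma convolution_scale_right: "convolution (\<otimes>) f (scale c g) = scale c (convolution (\<otimes>) f g)"
proof -
  have "Poly_Mapping.keys f \<subseteq> UNIV" "Poly_Mapping.keys g \<subseteq> UNIV" by auto
  then show ?thesis
  proof (induction rule: poly_mapping_single_induct)
    case (add f x d)
    have "convolution (\<otimes>) (Poly_Mapping.single x d) (scale c g)
        = scale c (convolution (\<otimes>) (Poly_Mapping.single x d) g)"
      using \<open>Poly_Mapping.keys g \<subseteq> UNIV\<close>
      by (induction rule: poly_mapping_single_induct)
        (simp_all add: convolution_add_right convolution_single scale_simps mult.left_commute)
    then show ?case using add by (simp add: convolution_add_left scale_simps)
  qed (simp add: scale_simps)
qed

end

lemma group_algebra_simps:
  "carrier (group_algebra G) = {f. Poly_Mapping.keys f \<subseteq> carrier G}"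
  "f \<otimes>\<^bsub>group_algebra G\<^esub> g = convolution (\<otimes>\<^bsub>G\<^esub>) f g"
  "\<one>\<^bsub>group_algebra G\<^esub> = Poly_Mapping.single \<one>\<^bsub>G\<^esub> 1" "\<zero>\<^bsub>group_algebra G\<^esub> = 0"
  "f \<oplus>\<^bsub>group_algebra G\<^esub> g = f + g" "c \<odot>\<^bsub>group_algebra G\<^esub> f = scale c f"
  by (simp_all add: group_algebra_def convolution_def scale_def)

lemma scalar_algebra_group_algebra:
  assumes "monoid G"
  shows "scalar_algebra (group_algebra G :: ('k::field, _) module)"
proof -
  interpret G: monoid G by fact
  let ?R = "group_algebra G :: ('k, _) module"
  have "ring ?R"
  proof (intro ringI)
    show "abelian_group ?R"
    proof (rule abelian_groupI)
      show "\<exists>y\<in>carrier ?R. y \<oplus>\<^bsub>?R\<^esub> x = \<zero>\<^bsub>?R\<^esub>" if "x \<in> carrier ?R" for x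
        using that by (intro bexI[of _ "- x"]) (auto simp: group_algebra_simps in_keys_iff)
      show "x \<oplus>\<^bsub>?R\<^esub> y \<in> carrier ?R" if "x \<in> carrier ?R" "y \<in> carrier ?R" for x y
        using that keys_add[of x y] by (auto simp: group_algebra_simps)
    qed (auto simp: group_algebra_simps algebra_simps)
    show "monoid ?R"
      by (rule monoidI)
        (simp_all add: group_algebra_simps keys_convolution[OF assms] convolution_assoc[OF assms]
          convolution_one[OF assms])
  qed (auto simp: group_algebra_simps convolution_add_left convolution_add_right)
  then show ?thesis
  proof (intro scalar_algebra.intro scalar_algebra_axioms.intro)
    show "c \<odot>\<^bsub>?R\<^esub> x \<in> carrier ?R" if "x \<in> carrier ?R" for c x
      using that keys_scale[of c x] by (auto simp: group_algebra_simps)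
  qed (simp_all add: group_algebra_simps scale_simps
        convolution_scale_left[OF assms] convolution_scale_right[OF assms])
qed

subsection \<open>Quotients of the braid group algebra\<close>

context scalar_algebra
begin

lemma inv_eqI:
  assumes "x \<in> carrier A" "y \<in> carrier A" "x \<otimes> y = \<one>" "y \<otimes> x = \<one>"
  shows "inv x = y"
  unfolding m_inv_def using assms inv_unique by (intro the_equality) blast+

lemma kappa_eq:
  assumes "x \<in> carrier A" "y \<in> carrier A" "x \<otimes> y = \<one>" "y \<otimes> x = \<one>"
  shows "kappa A q x =
    \<one> \<oplus> (- inverse (q - inverse q)) \<odot> x \<oplus> inverse (q - inverse q) \<odot> y"
  using assms
  by (simp add: kappa_def inv_eqI[OF assms] minus_smult smult_r_distr smult_smult a_assoc)

end

locale algebra_ideal = scalar_algebra R + ideal I R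
  for R :: "('k::field, 'a) module" (structure) and I
begin

abbreviation Q :: "('k, 'a set) module" where
  "Q \<equiv> quotient_algebra R I"

lemma quotient_algebra_simps:
  "carrier Q = a_rcosets I" "\<one>\<^bsub>Q\<^esub> = I +> \<one>" "\<zero>\<^bsub>Q\<^esub> = I"
  "U \<oplus>\<^bsub>Q\<^esub> V = U <+> V" "U \<otimes>\<^bsub>Q\<^esub> V = [mod I:] U \<Otimes> V"
  "c \<odot>\<^bsub>Q\<^esub> U = (\<Union>x\<in>U. I +> (c \<odot> x))"
  by (simp_all add: quotient_algebra_def ring.defs module.defs FactRing_def)

text \<open>Scaling by \<open>c\<close> is multiplication by \<open>c \<odot> \<one>\<close>, so a
  ring ideal is automatically a subspace.\<close>

lemma smult_ideal: "h \<in> I \<Longrightarrow> c \<odot> h \<in> I"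
  using I_l_closed[of h "c \<odot> \<one>"] smult_mult[of \<one> h c] Icarr[of h] by simp

lemma proj_closed: "x \<in> carrier R \<Longrightarrow> I +> x \<in> carrier Q"
  by (simp add: quotient_algebra_simps a_rcosetsI a_subset)

lemma proj_surj: "U \<in> carrier Q \<Longrightarrow> \<exists>x\<in>carrier R. U = I +> x"
  by (auto simp: quotient_algebra_simps A_RCOSETS_def' )

lemma proj_one: "\<one>\<^bsub>Q\<^esub> = I +> \<one>"
  by (simp add: quotient_algebra_simps)

lemma proj_zero: "\<zero>\<^bsub>Q\<^esub> = I +> \<zero>"
  by (simp add: quotient_algebra_simps a_rcos_const)

lemma proj_add: "x \<in> carrier R \<Longrightarrow> y \<in> carrier R \<Longrightarrow> (I +> x) \<oplus>\<^bsub>Q\<^esub> (I +> y) = I +> (x \<oplus> y)"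
  by (simp add: quotient_algebra_simps a_rcos_sum)

lemma proj_mult: "x \<in> carrier R \<Longrightarrow> y \<in> carrier R \<Longrightarrow> (I +> x) \<otimes>\<^bsub>Q\<^esub> (I +> y) = I +> (x \<otimes> y)"
  by (simp add: quotient_algebra_simps rcoset_mult_add)

text \<open>The quotient defines scaling as a union of cosets over all representatives; by
  \<open>smult_ideal\<close> these cosets coincide.\<close>

lemma proj_smult:
  assumes x: "x \<in> carrier R" shows "c \<odot>\<^bsub>Q\<^esub> (I +> x) = I +> (c \<odot> x)"
proof -
  have "I +> (c \<odot> y) = I +> (c \<odot> x)" if "y \<in> I +> x" for y
  proof -
    from that obtain h where h: "h \<in> I" "y = h \<oplus> x"
      by (auto simp: a_r_coset_def')
    then have "c \<odot> y = c \<odot> h \<oplus> c \<odot> x" using x Icarr by (simp add: smult_r_distr)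
    then have "c \<odot> y \<in> I +> (c \<odot> x)"
      using a_rcosI[OF smult_ideal[OF h(1)] a_subset, of "c \<odot> x"] x by simp
    then show ?thesis using a_repr_independence' x by auto
  qed
  moreover have "x \<in> I +> x" using x by (rule a_rcos_self)
  ultimately have "(\<Union>y\<in>I +> x. I +> (c \<odot> y)) = I +> (c \<odot> x)" by blast
  then show ?thesis by (simp add: quotient_algebra_simps)
qed

lemmas proj_simps = proj_add proj_mult proj_smult

lemma scalar_algebra_quotient: "scalar_algebra Q"
proof -
  have "ring Q"
  proof (intro ringI)
    show "abelian_group Q"
    proof (rule abelian_groupI)
      show "\<exists>V\<in>carrier Q. V \<oplus>\<^bsub>Q\<^esub> U = \<zero>\<^bsub>Q\<^esub>" if U: "U \<in> carrier Q" for U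
      proof -
        obtain x where x: "x \<in> carrier R" "U = I +> x" using proj_surj[OF U] by blast
        then show ?thesis
          by (intro bexI[of _ "I +> (\<ominus> x)"]) (simp_all add: proj_add proj_zero l_neg proj_closed)
      qed
    qed (auto dest!: proj_surj simp: proj_add proj_zero proj_closed a_ac)
    show "monoid Q"
      by (rule monoidI) (auto dest!: proj_surj simp: proj_mult proj_one proj_closed m_assoc)
  qed (auto dest!: proj_surj simp: proj_add proj_mult l_distr r_distr)
  then show ?thesis
    by (intro scalar_algebra.intro scalar_algebra_axioms.intro)
      (auto dest!: proj_surj simp: proj_simps proj_closed smult_l_distr smult_r_distr smult_smult
        smult_mult mult_smult)
qed

lemma proj_eqI: "x \<in> carrier R \<Longrightarrow> y \<in> carrier R \<Longrightarrow> x \<ominus> y \<in> I \<Longrightarrow> I +> x = I +> y"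
  using quotient_eq_iff_same_a_r_cos[OF ideal_axioms] by blast

end

section \<open>Words in the braid group algebra and its character\<close>

definition braid_word_elt :: "nat \<Rightarrow> braid_word \<Rightarrow> braid_word set \<Rightarrow>\<^sub>0 'k::field" where
  "braid_word_elt n u = Poly_Mapping.single (braid_class n u) 1"

lemma braid_elt_eq: "braid_elt n i = braid_word_elt n [(i, True)]"
  by (simp add: braid_elt_def braid_gen_def braid_word_elt_def braid_class_def)

lemma braid_word_elt_closed: "u \<in> braid_words n \<Longrightarrow> braid_word_elt n u \<in> carrier (braid_algebra n)"
  by (simp add: braid_word_elt_def group_algebra_simps braid_class_closed)

lemma braid_word_elt_Nil: "\<one>\<^bsub>braid_algebra n\<^esub> = braid_word_elt n []"
  by (simp add: braid_word_elt_def group_algebra_simps one_braid_group)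

lemma braid_word_elt_mult:
  "u \<in> braid_words n \<Longrightarrow> v \<in> braid_words n \<Longrightarrow>
    braid_word_elt n u \<otimes>\<^bsub>braid_algebra n\<^esub> braid_word_elt n v = braid_word_elt n (u @ v)"
  by (simp add: braid_word_elt_def group_algebra_simps convolution_single mult_braid_class)

lemma braid_word_elt_eq: "(u, v) \<in> braid_rel n \<Longrightarrow> braid_word_elt n u = braid_word_elt n v"
  by (simp add: braid_word_elt_def braid_class_eq)

definition braid_char :: "'k::field \<Rightarrow> (braid_word set \<Rightarrow>\<^sub>0 'k) \<Rightarrow> 'k" where
  "braid_char q f = (\<Sum>U\<in>Poly_Mapping.keys f. Poly_Mapping.lookup f U * class_weight q U)"

lemma braid_char_single: "braid_char q (Poly_Mapping.single U c) = c * class_weight q U"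
  by (simp add: braid_char_def)

lemma braid_char_zero: "braid_char q 0 = 0"
  by (simp add: braid_char_def)

lemma braid_char_add: "braid_char q (f + g) = braid_char q f + braid_char q g"
  unfolding braid_char_def
  by (rule setsum_keys_plus_distrib[where f = "\<lambda>U c. c * class_weight q U"])
    (simp_all add: distrib_right)

lemma braid_char_scale: "braid_char q (scale c f) = c * braid_char q f"
proof -
  have "Poly_Mapping.keys f \<subseteq> UNIV" by simp
  then show ?thesis
    by (induction rule: poly_mapping_single_induct)
      (simp_all add: braid_char_zero braid_char_add scale_simps braid_char_single distrib_left mult.assoc)
qed

lemma braid_char_word: "q \<noteq> 0 \<Longrightarrow> u \<in> braid_words n \<Longrightarrow> braid_char q (braid_word_elt n u) = word_weight q u"
  by (simp add: braid_word_elt_def braid_char_single class_weight_braid_class)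

lemma braid_char_mult:
  assumes q: "q \<noteq> 0"
    and f: "f \<in> carrier (braid_algebra n)" and g: "g \<in> carrier (braid_algebra n)"
  shows "braid_char q (f \<otimes>\<^bsub>braid_algebra n\<^esub> g) = braid_char q f * braid_char q g"
proof -
  let ?G = "braid_group n"
  have w: "class_weight q (U \<otimes>\<^bsub>?G\<^esub> V) = class_weight q U * class_weight q V"
    if UV: "U \<in> carrier ?G" "V \<in> carrier ?G" for U V
  proof -
    obtain u v where uv: "u \<in> braid_words n" "v \<in> braid_words n" "U = braid_class n u" "V = braid_class n v"
      using UV by (auto simp: carrier_braid_group)
    then have "u @ v \<in> braid_words n" by (auto simp: braid_words_def)
    then show ?thesis
      using uv q by (simp add: mult_braid_class class_weight_braid_class word_weight_append)
  qed
  have keys: "Poly_Mapping.keys f \<subseteq> carrier ?G" "Poly_Mapping.keys g \<subseteq> carrier ?G"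
    using f g by (simp_all add: group_algebra_simps)
  have "braid_char q (convolution (\<otimes>\<^bsub>?G\<^esub>) f g) = braid_char q f * braid_char q g"
    using keys(1)
  proof (induction rule: poly_mapping_single_induct)
    case (add f U c)
    have "braid_char q (convolution (\<otimes>\<^bsub>?G\<^esub>) (Poly_Mapping.single U c) g)
        = c * class_weight q U * braid_char q g"
      using keys(2)
      by (induction rule: poly_mapping_single_induct)
        (use add.hyps in \<open>simp_all add: braid_char_zero braid_char_add convolution_add_right
          convolution_single braid_char_single w distrib_left mult_ac\<close>)
    then show ?case
      using add by (simp add: convolution_add_left braid_char_add braid_char_single distrib_right)
  qed (simp add: braid_char_zero)
  then show ?thesis by (simp add: group_algebra_simps)
qed

text \<open>With the minimality of generated ideals, it is enough to evaluate the character on the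
  generators of the Hecke and BMW ideals in order to let it descend to the quotient.\<close>

lemma ideal_braid_char_kernel:
  assumes "q \<noteq> 0"
  shows "ideal {f \<in> carrier (braid_algebra n). braid_char q f = 0} (braid_algebra n)"
proof -
  let ?R = "braid_algebra n :: ('a, _) module"
  let ?K = "{f \<in> carrier ?R. braid_char q f = 0}"
  interpret R: scalar_algebra ?R
    by (rule scalar_algebra_group_algebra[OF monoid_braid_group])
  have c_inv: "braid_char q (\<ominus>\<^bsub>?R\<^esub> f) = 0" if "f \<in> ?K" for f
    using that R.a_inv_smult[of f] by (simp add: group_algebra_simps braid_char_scale)
  show ?thesis
  proof (rule idealI)
    show "ring ?R" ..
    show "subgroup ?K (add_monoid ?R)"
    proof (rule R.add.subgroupI)
      have "\<zero>\<^bsub>?R\<^esub> \<in> ?K" using R.zero_closed by (simp add: group_algebra_simps braid_char_zero)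
      then show "?K \<noteq> {}" by blast
      show "\<ominus>\<^bsub>?R\<^esub> f \<in> ?K" if "f \<in> ?K" for f
        using c_inv[OF that] that R.a_inv_closed by simp
      show "f \<oplus>\<^bsub>?R\<^esub> g \<in> ?K" if "f \<in> ?K" "g \<in> ?K" for f g
        using that R.a_closed[of f g] by (simp add: group_algebra_simps braid_char_add)
    qed auto
  qed (use assms in \<open>auto simp: braid_char_mult\<close>)
qed

text \<open>Containment of \<open>I\<close> in the kernel of the character is the only property of
  the ideal that enters, so the same lemma serves both algebras.\<close>

lemma braid_system_quotient:
  fixes q :: "'k::field"
  assumes N: "N = n + 1"
    and q: "q \<noteq> 0" "q\<^sup>2 \<noteq> 1" "\<forall>k\<in>{2..n + 1}. qnum q k \<noteq> 0"
    and I: "ideal I (braid_algebra N)" and I_ker: "\<And>f. f \<in> I \<Longrightarrow> braid_char q f = 0"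
  shows "braid_system (quotient_algebra (braid_algebra N) I) q n
    (\<lambda>i. I +>\<^bsub>braid_algebra N\<^esub> braid_elt N i)
    (\<lambda>i. I +>\<^bsub>braid_algebra N\<^esub> braid_word_elt N [(i, False)])
    (\<lambda>U. the_elem (braid_char q ` U))"
proof -
  let ?R = "braid_algebra N :: ('k, _) module"
  let ?w = "braid_word_elt N"
  interpret algebra_ideal ?R I
    by (rule algebra_ideal.intro[OF scalar_algebra_group_algebra[OF monoid_braid_group] I])
  have letter: "[(i, b)] \<in> braid_words N" if "i \<in> {1..n}" for i b
    using that by (auto simp: braid_words_def N)
  note closed = braid_word_elt_closed[of _ N]
  have w_mult: "(I +>\<^bsub>?R\<^esub> ?w u) \<otimes>\<^bsub>Q\<^esub> (I +>\<^bsub>?R\<^esub> ?w v) = I +>\<^bsub>?R\<^esub> ?w (u @ v)"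
    if "u \<in> braid_words N" "v \<in> braid_words N" for u v
    using that by (simp add: proj_mult closed braid_word_elt_mult)
  have app: "u @ v \<in> braid_words N" if "u \<in> braid_words N" "v \<in> braid_words N" for u v
    using that by (auto simp: braid_words_def)
  \<comment> \<open>The character is constant on cosets, so \<open>the_elem\<close> recovers its
    value from any representative.\<close>
  have char: "the_elem (braid_char q ` (I +>\<^bsub>?R\<^esub> f)) = braid_char q f" if "f \<in> carrier ?R" for f
  proof -
    have "braid_char q g = braid_char q f" if "g \<in> I +>\<^bsub>?R\<^esub> f" for g
      using that I_ker by (auto simp: a_r_coset_def' group_algebra_simps braid_char_add)
    moreover have "f \<in> I +>\<^bsub>?R\<^esub> f" using that by (rule a_rcos_self)
    ultimately have "braid_char q ` (I +>\<^bsub>?R\<^esub> f) = {braid_char q f}" by blast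
    then show ?thesis by simp
  qed
  show ?thesis
    unfolding braid_elt_eq
  proof (intro braid_system.intro braid_system_axioms.intro scalar_algebra_quotient q)
    fix i assume i: "i \<in> {1..n}"
    have "([(i, b), (i, \<not> b)], []) \<in> braid_rel N" for b
      using i by (intro braid_rel.cancel) (auto simp: N)
    from this[of True] this[of False]
    show "(I +>\<^bsub>?R\<^esub> ?w [(i, True)]) \<otimes>\<^bsub>Q\<^esub> (I +>\<^bsub>?R\<^esub> ?w [(i, False)]) = \<one>\<^bsub>Q\<^esub>"
      and "(I +>\<^bsub>?R\<^esub> ?w [(i, False)]) \<otimes>\<^bsub>Q\<^esub> (I +>\<^bsub>?R\<^esub> ?w [(i, True)]) = \<one>\<^bsub>Q\<^esub>"
      using letter[OF i] by (simp_all add: w_mult proj_one braid_word_elt_Nil braid_word_elt_eq)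
  next
    fix i assume i: "i \<in> {1..<n}"
    have br: "([(i, True), (Suc i, True), (i, True)], [(Suc i, True), (i, True), (Suc i, True)]) \<in> braid_rel N"
      using i by (intro braid_rel.braid) (auto simp: N)
    show "(I +>\<^bsub>?R\<^esub> ?w [(i, True)]) \<otimes>\<^bsub>Q\<^esub> ((I +>\<^bsub>?R\<^esub> ?w [(Suc i, True)]) \<otimes>\<^bsub>Q\<^esub> (I +>\<^bsub>?R\<^esub> ?w [(i, True)]))
      = (I +>\<^bsub>?R\<^esub> ?w [(Suc i, True)]) \<otimes>\<^bsub>Q\<^esub> ((I +>\<^bsub>?R\<^esub> ?w [(i, True)]) \<otimes>\<^bsub>Q\<^esub> (I +>\<^bsub>?R\<^esub> ?w [(Suc i, True)]))"
      using letter[of i] letter[of "Suc i"] app[OF letter letter, of i "Suc i"]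
        app[OF letter letter, of "Suc i" i] i
      by (simp add: w_mult braid_word_elt_eq[OF br])
  next
    fix i j assume ij: "i \<in> {1..n}" "j \<in> {1..n}" "1 < \<bar>int i - int j\<bar>"
    have br: "([(i, True), (j, True)], [(j, True), (i, True)]) \<in> braid_rel N"
      using ij by (intro braid_rel.commute) (auto simp: N)
    show "(I +>\<^bsub>?R\<^esub> ?w [(i, True)]) \<otimes>\<^bsub>Q\<^esub> (I +>\<^bsub>?R\<^esub> ?w [(j, True)])
      = (I +>\<^bsub>?R\<^esub> ?w [(j, True)]) \<otimes>\<^bsub>Q\<^esub> (I +>\<^bsub>?R\<^esub> ?w [(i, True)])"
      using letter[OF ij(1)] letter[OF ij(2)] by (simp add: w_mult braid_word_elt_eq[OF br])
  next
    fix U V assume "U \<in> carrier Q" "V \<in> carrier Q"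
    then obtain f g where fg: "f \<in> carrier ?R" "U = I +>\<^bsub>?R\<^esub> f" "g \<in> carrier ?R" "V = I +>\<^bsub>?R\<^esub> g"
      using proj_surj by metis
    show "the_elem (braid_char q ` (U \<oplus>\<^bsub>Q\<^esub> V)) = the_elem (braid_char q ` U) + the_elem (braid_char q ` V)"
      using fg by (simp add: proj_add char) (simp add: braid_char_add group_algebra_simps(5))
    show "the_elem (braid_char q ` (U \<otimes>\<^bsub>Q\<^esub> V)) = the_elem (braid_char q ` U) * the_elem (braid_char q ` V)"
      using fg q(1) by (simp add: proj_mult char braid_char_mult)
  next
    fix U c assume "U \<in> carrier Q"
    then obtain f where f: "f \<in> carrier ?R" "U = I +>\<^bsub>?R\<^esub> f" using proj_surj by metis
    show "the_elem (braid_char q ` (c \<odot>\<^bsub>Q\<^esub> U)) = c * the_elem (braid_char q ` U)"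
      using f by (simp add: proj_smult char) (simp add: braid_char_scale group_algebra_simps(6))
  next
    have "[] \<in> braid_words N" by (simp add: braid_words_def)
    then show "the_elem (braid_char q ` \<one>\<^bsub>Q\<^esub>) = 1"
      using q(1) by (simp add: proj_one braid_word_elt_Nil closed char braid_char_word word_weight_def)
  next
    fix B
    assume B: "B \<subseteq> carrier Q" "\<one>\<^bsub>Q\<^esub> \<in> B" "\<And>x y. x \<in> B \<Longrightarrow> y \<in> B \<Longrightarrow> x \<oplus>\<^bsub>Q\<^esub> y \<in> B"
      "\<And>x y. x \<in> B \<Longrightarrow> y \<in> B \<Longrightarrow> x \<otimes>\<^bsub>Q\<^esub> y \<in> B" "\<And>c x. x \<in> B \<Longrightarrow> c \<odot>\<^bsub>Q\<^esub> x \<in> B"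
      "\<And>i. i \<in> {1..n} \<Longrightarrow> I +>\<^bsub>?R\<^esub> ?w [(i, True)] \<in> B"
      "\<And>i. i \<in> {1..n} \<Longrightarrow> I +>\<^bsub>?R\<^esub> ?w [(i, False)] \<in> B"
    \<comment> \<open>Words are products of letters, and every element of the group algebra is a
      linear combination of words; this yields generation.\<close>
    have words: "I +>\<^bsub>?R\<^esub> ?w u \<in> B" if "u \<in> braid_words N" for u
      using that
    proof (induction u)
      case Nil
      then show ?case using B(2) by (simp add: proj_one braid_word_elt_Nil)
    next
      case (Cons a u)
      obtain i b where a: "a = (i, b)" by (cases a)
      have i: "i \<in> {1..n}" and u: "u \<in> braid_words N" using Cons.prems a by (auto simp: braid_words_def N)
      have "I +>\<^bsub>?R\<^esub> ?w [(i, b)] \<in> B" using B(6,7)[OF i] by (cases b) auto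
      then have "(I +>\<^bsub>?R\<^esub> ?w [(i, b)]) \<otimes>\<^bsub>Q\<^esub> (I +>\<^bsub>?R\<^esub> ?w u) \<in> B" using Cons.IH[OF u] B(4) by blast
      then show ?case using w_mult[OF letter[OF i] u] a by simp
    qed
    have "I +>\<^bsub>?R\<^esub> f \<in> B" if "f \<in> carrier ?R" for f
    proof -
      have "Poly_Mapping.keys f \<subseteq> carrier (braid_group N)" using that by (simp add: group_algebra_simps)
      then show ?thesis
      proof (induction rule: poly_mapping_single_induct)
        case zero
        have "0 \<odot>\<^bsub>Q\<^esub> \<one>\<^bsub>Q\<^esub> \<in> B" using B(2,5) by blast
        then show ?case by (simp add: proj_one proj_smult) (simp add: group_algebra_simps)
      next
        case (add f U c)
        obtain u where u: "u \<in> braid_words N" "U = braid_class N u"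
          using add.hyps by (auto simp: carrier_braid_group)
        have f: "f \<in> carrier ?R" using add.hyps by (simp add: group_algebra_simps)
        have "(c \<odot>\<^bsub>Q\<^esub> (I +>\<^bsub>?R\<^esub> ?w u)) \<oplus>\<^bsub>Q\<^esub> (I +>\<^bsub>?R\<^esub> f) \<in> B"
          using B(3,5) words[OF u(1)] add.IH by blast
        moreover have "c \<odot>\<^bsub>?R\<^esub> ?w u \<oplus>\<^bsub>?R\<^esub> f = Poly_Mapping.single U c + f"
          by (simp add: group_algebra_simps braid_word_elt_def scale_simps u)
        ultimately show ?case
          using f by (simp add: closed[OF u(1)] proj_smult proj_add)
      qed
    qed
    then show "carrier Q \<subseteq> B" using proj_surj by blast
  qed (use letter q(1) in
      \<open>auto simp: closed proj_closed char braid_char_word word_weight_def\<close>)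
qed

subsection \<open>Relations in the Birman--Murakami--Wenzl algebra\<close>

context scalar_algebra
begin

lemma inverse_intertwine:
  assumes c: "x \<in> carrier A" "u \<in> carrier A" "u' \<in> carrier A" "v \<in> carrier A" "v' \<in> carrier A"
    and inv: "u \<otimes> u' = \<one>" "v' \<otimes> v = \<one>" and x: "x \<otimes> u = v \<otimes> x"
  shows "x \<otimes> u' = v' \<otimes> x"
proof -
  have "x \<otimes> u' = (v' \<otimes> v) \<otimes> (x \<otimes> u')" using c inv by simp
  also have "\<dots> = v' \<otimes> ((v \<otimes> x) \<otimes> u')" using c by (simp add: m_assoc)
  also have "\<dots> = v' \<otimes> x" using c by (simp add: x[symmetric] m_assoc inv)
  finally show ?thesis .
qed

text \<open>If \<open>x\<close> intertwines \<open>u\<close> and \<open>v\<close>, it also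
  intertwines their inverses, and \<open>kappa\<close> is a linear combination of the unit, the
  element and its inverse.\<close>

lemma kappa_intertwine:
  assumes c: "x \<in> carrier A" "u \<in> carrier A" "u' \<in> carrier A" "v \<in> carrier A" "v' \<in> carrier A"
    and inv: "u \<otimes> u' = \<one>" "u' \<otimes> u = \<one>" "v \<otimes> v' = \<one>" "v' \<otimes> v = \<one>"
    and x: "x \<otimes> u = v \<otimes> x"
  shows "x \<otimes> kappa A q u = kappa A q v \<otimes> x"
  using c inverse_intertwine[OF c inv(1,4) x] x
  by (simp add: kappa_eq[OF c(2,3) inv(1,2)] kappa_eq[OF c(4,5) inv(3,4)] l_distr r_distr
      smult_mult mult_smult)

lemma right_cancel_unit:
  assumes c: "a \<in> carrier A" "b \<in> carrier A" "x \<in> carrier A" "y \<in> carrier A"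
    and "x \<otimes> y = \<one>" "a \<otimes> x = b \<otimes> x"
  shows "a = b"
proof -
  have "(a \<otimes> x) \<otimes> y = (b \<otimes> x) \<otimes> y" using assms by simp
  then show ?thesis using assms(1-5) by (simp add: m_assoc)
qed

end

text \<open>The presentation sandwiches only \<open>s i\<close> and \<open>r i\<close> between two
  factors \<open>k (Suc i)\<close>; the mirrored relation, with \<open>k i\<close> outside, is
  derived as \<open>ktk\<close>.\<close>

locale bmw_system = braid_system A q n s r \<chi>
  for A :: "('k::field, 'a) module" (structure) and q n s r \<chi> +
  fixes k :: "nat \<Rightarrow> 'a" and \<nu> z :: 'k
  assumes z: "z = q - inverse q" and \<nu>_nz: "\<nu> \<noteq> 0" and \<nu>_q: "\<nu> \<noteq> q"
    and \<nu>_pow: "j \<in> {1..n} \<Longrightarrow> \<nu> \<noteq> q ^ (2 * j - 1)"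
    and k_kappa: "i \<in> {1..n} \<Longrightarrow> k i = kappa A q (s i)"
    and k_s: "i \<in> {1..n} \<Longrightarrow> k i \<otimes> s i = \<nu> \<odot> k i"
    and s_k: "i \<in> {1..n} \<Longrightarrow> s i \<otimes> k i = \<nu> \<odot> k i"
    and lsl: "i \<in> {1..<n} \<Longrightarrow> k (Suc i) \<otimes> (s i \<otimes> k (Suc i)) = inverse \<nu> \<odot> k (Suc i)"
    and lrl: "i \<in> {1..<n} \<Longrightarrow> k (Suc i) \<otimes> (r i \<otimes> k (Suc i)) = \<nu> \<odot> k (Suc i)"
begin

lemma z_nz: "z \<noteq> 0"
  using q_nz q_sq by (auto simp: z field_simps power2_eq_square)

lemma k_eq: "i \<in> {1..n} \<Longrightarrow> k i = \<one> \<oplus> (- inverse z) \<odot> s i \<oplus> inverse z \<odot> r i"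
  using kappa_eq[OF s_closed r_closed s_r r_s, of i q] by (simp add: k_kappa z)

lemma k_closed: "i \<in> {1..n} \<Longrightarrow> k i \<in> carrier A"
  by (simp add: k_eq s_closed r_closed)

lemma r_eq:
  assumes "i \<in> {1..n}" shows "r i = s i \<oplus> (- z) \<odot> \<one> \<oplus> z \<odot> k i"
proof -
  let ?L = "combo \<one> (s i) (r i) \<zero> \<zero> \<zero>"
  note c = s_closed[OF assms] r_closed[OF assms]
  have "z \<odot> k i = ?L z (- 1) 1 0 0 0"
    using c z_nz by (simp add: k_eq[OF assms] combo_def smult_r_distr smult_smult a_ac)
  moreover have "s i \<oplus> (- z) \<odot> \<one> = ?L (- z) 1 0 0 0 0"
    using c by (simp add: combo_def a_ac)
  ultimately have "s i \<oplus> (- z) \<odot> \<one> \<oplus> z \<odot> k i = ?L 0 0 1 0 0 0"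
    using c by (simp add: combo_simps)
  then show ?thesis using c by (simp add: combo_def)
qed

text \<open>Multiply the formula \<open>r_eq\<close> for the inverse by \<open>s i\<close> and use
  \<open>s_k\<close>.\<close>

lemma quad:
  assumes "i \<in> {1..n}" shows "s i \<otimes> s i = \<one> \<oplus> z \<odot> s i \<oplus> (- z * \<nu>) \<odot> k i"
proof -
  let ?L = "combo (s i \<otimes> s i) (s i) (k i) \<zero> \<zero> \<zero>"
  note c = s_closed[OF assms] k_closed[OF assms]
  have "\<one> = s i \<otimes> (s i \<oplus> (- z) \<odot> \<one> \<oplus> z \<odot> k i)" using s_r[OF assms] r_eq[OF assms] by simp
  also have "\<dots> = ?L 1 (- z) (z * \<nu>) 0 0 0"
    using c by (simp add: r_distr mult_smult s_k[OF assms] smult_smult combo_def a_ac)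
  finally have one: "\<one> = ?L 1 (- z) (z * \<nu>) 0 0 0" .
  have "z \<odot> s i \<oplus> (- z * \<nu>) \<odot> k i = ?L 0 z (- z * \<nu>) 0 0 0" using c by (simp add: combo_def)
  then have "\<one> \<oplus> (z \<odot> s i \<oplus> (- z * \<nu>) \<odot> k i) = ?L 1 0 0 0 0 0"
    using c by (subst one) (simp add: combo_simps)
  then show ?thesis using c by (simp add: combo_def a_assoc)
qed

lemma comm_s_k:
  assumes "i \<in> {1..n}" "j \<in> {1..n}" "\<bar>int i - int j\<bar> > 1"
  shows "s i \<otimes> k j = k j \<otimes> s i"
  using kappa_intertwine[OF s_closed s_closed r_closed s_closed r_closed s_r r_s s_r r_s comm_s, of i j]
    assms by (simp add: k_kappa)

context
  fixes i assumes i: "i \<in> {1..<n}"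
begin

definition t where "t = s (Suc i)"
definition l where "l = k (Suc i)"
definition t' where "t' = r (Suc i)"

lemma i1: "i \<in> {1..n}" and i2: "Suc i \<in> {1..n}" using i by auto

lemma closed: "s i \<in> carrier A" "k i \<in> carrier A" "t \<in> carrier A" "l \<in> carrier A"
    "r i \<in> carrier A" "t' \<in> carrier A"
  using s_closed[OF i1] k_closed[OF i1] r_closed[OF i1] s_closed[OF i2] k_closed[OF i2] r_closed[OF i2]
  by (simp_all add: t_def l_def t'_def)

lemma sts_tst: "s i \<otimes> (t \<otimes> s i) = t \<otimes> (s i \<otimes> t)"
  using braid_s[OF i] by (simp add: t_def)

text \<open>The braid relation says that \<open>t \<otimes> s i\<close> intertwines \<open>t\<close>
  and \<open>s i\<close>, hence also their kappas. In the next lemma \<open>s i \<otimes> t\<close>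
  does the same in the other direction.\<close>

lemma tsl_kts: "t \<otimes> (s i \<otimes> l) = k i \<otimes> (t \<otimes> s i)"
  using kappa_intertwine[of "t \<otimes> s i" t t' "s i" "r i" q] closed sts_tst
    s_r[OF i1] r_s[OF i1] s_r[OF i2] r_s[OF i2]
  by (simp add: m_assoc k_kappa[OF i1] k_kappa[OF i2] l_def flip: t_def t'_def)

lemma stk_lst: "s i \<otimes> (t \<otimes> k i) = l \<otimes> (s i \<otimes> t)"
  using kappa_intertwine[of "s i \<otimes> t" "s i" "r i" t t' q] closed sts_tst
    s_r[OF i1] r_s[OF i1] s_r[OF i2] r_s[OF i2]
  by (simp add: m_assoc k_kappa[OF i1] k_kappa[OF i2] l_def flip: t_def t'_def)

text \<open>Conjugation by \<open>s t s\<close> exchanges the indices \<open>i\<close> and \<open>Suc i\<close> in \<open>lsl\<close>.\<close>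

lemma ktk: "k i \<otimes> (t \<otimes> k i) = inverse \<nu> \<odot> k i"
proof -
  define x where "x = s i \<otimes> (t \<otimes> s i)"
  have x: "x \<in> carrier A" using closed by (simp add: x_def)
  have xl: "x \<otimes> l = k i \<otimes> x"
  proof -
    have "x \<otimes> l = (s i \<otimes> k i) \<otimes> (t \<otimes> s i)"
      using closed by (simp add: x_def m_assoc tsl_kts)
    also have "\<dots> = (k i \<otimes> s i) \<otimes> (t \<otimes> s i)" by (simp add: s_k[OF i1] k_s[OF i1])
    finally show ?thesis using closed by (simp add: x_def m_assoc)
  qed
  have xs: "t \<otimes> x = x \<otimes> s i"
  proof -
    have "t \<otimes> x = (t \<otimes> (s i \<otimes> t)) \<otimes> s i" using closed by (simp add: x_def m_assoc)
    then show ?thesis by (simp add: x_def sts_tst)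
  qed
  \<comment> \<open>Carrying \<open>x\<close> to the left through the three factors turns k t k x
    into x l s l, where \<open>lsl\<close> applies.\<close>
  have "(k i \<otimes> (t \<otimes> k i)) \<otimes> x = k i \<otimes> ((t \<otimes> x) \<otimes> l)"
    using closed x by (simp add: m_assoc xl)
  also have "\<dots> = (x \<otimes> l) \<otimes> (s i \<otimes> l)"
    unfolding xs xl using closed x by (simp add: m_assoc)
  also have "\<dots> = x \<otimes> (inverse \<nu> \<odot> l)"
    using closed x lsl[OF i] by (simp add: m_assoc l_def)
  also have "\<dots> = (inverse \<nu> \<odot> k i) \<otimes> x"
    using closed x by (simp add: mult_smult smult_mult xl)
  finally have eq: "(k i \<otimes> (t \<otimes> k i)) \<otimes> x = (inverse \<nu> \<odot> k i) \<otimes> x" .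
  have "x \<otimes> (r i \<otimes> (t' \<otimes> r i)) = s i \<otimes> (t \<otimes> ((s i \<otimes> r i) \<otimes> (t' \<otimes> r i)))"
    using closed by (simp add: x_def m_assoc)
  also have "\<dots> = s i \<otimes> ((t \<otimes> t') \<otimes> r i)"
    using closed by (simp add: s_r[OF i1] m_assoc)
  also have "\<dots> = \<one>" using closed s_r[OF i1] s_r[OF i2] by (simp flip: t_def t'_def)
  finally show ?thesis
    using right_cancel_unit[OF _ _ x _ _ eq, of "r i \<otimes> (t' \<otimes> r i)"] closed by simp
qed

text \<open>Expand \<open>r i\<close> in \<open>lrl\<close> as s - z + z k: the term with
  \<open>s i\<close> is known from \<open>lsl\<close> and the constant term from the square of
  \<open>l\<close>, so \<open>lkl\<close> can be solved for, as \<open>z\<close> is nonzero.\<close>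

lemma lkl: "l \<otimes> (k i \<otimes> l) = l"
proof -
  let ?L = "combo l (l \<otimes> (k i \<otimes> l)) \<zero> \<zero> \<zero> \<zero>"
  have lt': "l \<otimes> t' = inverse \<nu> \<odot> l"
  proof -
    have "l = (l \<otimes> t) \<otimes> t'" using closed s_r[OF i2] by (simp add: m_assoc flip: t_def t'_def)
    also have "\<dots> = \<nu> \<odot> (l \<otimes> t')" using closed k_s[OF i2] by (simp add: smult_mult flip: t_def l_def)
    finally show ?thesis using smult_eq_iff[of "l \<otimes> t'" l \<nu>] closed \<nu>_nz by simp
  qed
  \<comment> \<open>The loop value of the BMW algebra, 1 - (\<nu> - 1/\<nu>)/z.\<close>
  have ll: "l \<otimes> l = (1 - inverse z * (\<nu> - inverse \<nu>)) \<odot> l"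
  proof -
    have "l \<otimes> l = l \<otimes> (\<one> \<oplus> (- inverse z) \<odot> t \<oplus> inverse z \<odot> t')"
      using k_eq[OF i2] by (simp flip: t_def l_def t'_def)
    also have "\<dots> = ?L 1 0 0 0 0 0 \<oplus> ?L (- inverse z * \<nu>) 0 0 0 0 0
        \<oplus> ?L (inverse z * inverse \<nu>) 0 0 0 0 0"
      using closed k_s[OF i2] lt'
      by (simp add: r_distr mult_smult smult_smult combo_def flip: t_def l_def)
    also have "\<dots> = ?L (1 - inverse z * (\<nu> - inverse \<nu>)) 0 0 0 0 0"
      using closed by (simp add: combo_simps algebra_simps)
    also have "\<dots> = (1 - inverse z * (\<nu> - inverse \<nu>)) \<odot> l"
      using closed by (simp add: combo_def)
    finally show ?thesis .
  qed
  have "?L \<nu> 0 0 0 0 0 = l \<otimes> (r i \<otimes> l)"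
    using lrl[OF i] closed by (simp add: combo_def flip: l_def)
  also have "\<dots> = l \<otimes> (s i \<otimes> l) \<oplus> (- z) \<odot> (l \<otimes> l) \<oplus> z \<odot> (l \<otimes> (k i \<otimes> l))"
    unfolding r_eq[OF i1] using closed by (simp add: l_distr r_distr smult_mult mult_smult)
  also have "\<dots> = ?L (inverse \<nu> - z * (1 - inverse z * (\<nu> - inverse \<nu>))) z 0 0 0 0"
    unfolding ll using lsl[OF i] closed
    by (simp add: smult_smult combo_def smult_l_distr[symmetric] a_assoc[symmetric] flip: l_def)
  also have "inverse \<nu> - z * (1 - inverse z * (\<nu> - inverse \<nu>)) = \<nu> - z"
    using z_nz by (simp add: algebra_simps)
  finally have "?L (- \<nu>) 0 0 0 0 0 \<oplus> ?L \<nu> 0 0 0 0 0 = ?L (- \<nu>) 0 0 0 0 0 \<oplus> ?L (\<nu> - z) z 0 0 0 0"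
    by simp
  then have "?L z 0 0 0 0 0 \<oplus> ?L 0 0 0 0 0 0 = ?L z 0 0 0 0 0 \<oplus> ?L (- z) z 0 0 0 0"
    using closed by (simp add: combo_simps)
  then have "z \<odot> l = z \<odot> (l \<otimes> (k i \<otimes> l))"
    using closed by (simp add: combo_simps) (simp add: combo_def)
  then show ?thesis
    using smult_eq_iff[of l "z \<odot> (l \<otimes> (k i \<otimes> l))" z] closed z_nz by (simp add: smult_smult)
qed

lemma ktkl: "\<nu> \<odot> (k i \<otimes> (t \<otimes> (k i \<otimes> l))) = k i \<otimes> l"
proof -
  have "k i \<otimes> (t \<otimes> (k i \<otimes> l)) = (k i \<otimes> (t \<otimes> k i)) \<otimes> l" using closed by (simp add: m_assoc)
  then show ?thesis using closed \<nu>_nz by (simp add: ktk smult_mult smult_smult)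
qed

text \<open>Replacing \<open>l\<close> by l k l in t s l creates k t s k l; there s k = \<nu> k, and
  \<nu> cancels against the factor from \<open>ktk\<close>.\<close>

lemma kts_kl: "k i \<otimes> (t \<otimes> s i) = k i \<otimes> l"
proof -
  have "k i \<otimes> (t \<otimes> s i) = t \<otimes> (s i \<otimes> (l \<otimes> (k i \<otimes> l)))" by (simp add: lkl tsl_kts)
  also have "\<dots> = (t \<otimes> (s i \<otimes> l)) \<otimes> (k i \<otimes> l)" using closed by (simp add: m_assoc)
  also have "\<dots> = k i \<otimes> (t \<otimes> ((s i \<otimes> k i) \<otimes> l))" unfolding tsl_kts using closed by (simp add: m_assoc)
  also have "\<dots> = \<nu> \<odot> (k i \<otimes> (t \<otimes> (k i \<otimes> l)))"
    using closed by (simp add: s_k[OF i1] smult_mult mult_smult)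
  finally show ?thesis by (simp add: ktkl)
qed

text \<open>The mirror image of the previous argument: l k l is inserted on the left,
  \<open>stk_lst\<close> moves \<open>k i\<close> to the right end, and k s = \<nu> k cancels the
  factor from \<open>ktk\<close>.\<close>

lemma lst_lk: "l \<otimes> (s i \<otimes> t) = l \<otimes> k i"
proof -
  have "l \<otimes> (s i \<otimes> t) = (l \<otimes> (k i \<otimes> l)) \<otimes> (s i \<otimes> t)" by (simp add: lkl)
  also have "\<dots> = l \<otimes> (k i \<otimes> (s i \<otimes> (t \<otimes> k i)))" using closed by (simp add: m_assoc stk_lst)
  also have "\<dots> = l \<otimes> ((k i \<otimes> s i) \<otimes> (t \<otimes> k i))" using closed by (simp add: m_assoc)
  also have "\<dots> = l \<otimes> k i"
    using closed \<nu>_nz by (simp add: k_s[OF i1] smult_mult mult_smult ktk smult_smult)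
  finally show ?thesis .
qed

lemma stkts_l: "s i \<otimes> (t \<otimes> (k i \<otimes> (t \<otimes> s i))) = l"
proof -
  have "s i \<otimes> (t \<otimes> (k i \<otimes> (t \<otimes> s i))) = (s i \<otimes> (t \<otimes> k i)) \<otimes> l"
    using closed by (simp add: kts_kl m_assoc)
  then show ?thesis using closed by (simp add: stk_lst lst_lk m_assoc lkl)
qed

end

section \<open>The coefficient of \<kappa> in the Baxterized elements\<close>

definition \<beta> :: "'k \<Rightarrow> 'k" where
  "\<beta> x = (x\<^sup>2 - 1) / (1 - inverse \<nu> * inverse q * x\<^sup>2)"

text \<open>A zero would mean \<nu> q = q^(2j), that is \<nu> = q^(2j-1), one of the excluded
  values.\<close>

lemma \<beta>_denominator:
  assumes "j \<in> {1..n}" shows "1 - inverse \<nu> * inverse q * (q ^ j)\<^sup>2 \<noteq> 0"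
proof
  assume "1 - inverse \<nu> * inverse q * (q ^ j)\<^sup>2 = 0"
  then have "\<nu> * q = (q ^ j)\<^sup>2" using \<nu>_nz q_nz by (simp add: field_simps)
  \<comment> \<open>Natural subtraction is harmless here because \<open>j\<close> is
    positive.\<close>
  also have "\<dots> = q ^ (2 * j - 1) * q"
    using assms by (cases j) (simp_all add: power2_eq_square mult_2_right power_add mult_ac)
  finally show False using \<nu>_pow[OF assms] q_nz by simp
qed

lemma baxter_system: "baxter_system A q n s r \<chi> k \<nu> z \<beta>"
proof (intro baxter_system.intro baxter_system_axioms.intro)
  show "braid_system A q n s r \<chi>" ..
  show "\<beta> q * (\<nu> - q) = q * z * \<nu>"
  proof -
    have "1 - inverse \<nu> * inverse q * q\<^sup>2 = (\<nu> - q) / \<nu>"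
      using \<nu>_nz q_nz by (simp add: field_simps power2_eq_square)
    then show ?thesis
      using \<nu>_nz \<nu>_q q_nz by (simp add: \<beta>_def z field_simps power2_eq_square)
  qed
next
  fix i x y assume i: "i \<in> {1..<n}" and x: "x = q ^ i" and y: "y = q ^ Suc i"
  define D where "D = 1 - inverse \<nu> * inverse q * x\<^sup>2"
  define D' where "D' = 1 - inverse \<nu> * inverse q * y\<^sup>2"
  have D: "D \<noteq> 0" "D' \<noteq> 0"
    using \<beta>_denominator[of i] \<beta>_denominator[of "Suc i"] i by (simp_all add: D_def D'_def x y)
  have yx: "y = q * x" using x y by simp
  have b: "\<beta> x = (x\<^sup>2 - 1) / D" "\<beta> y = (y\<^sup>2 - 1) / D'" by (simp_all add: \<beta>_def D_def D'_def)
  \<comment> \<open>Because \<open>q * z = q\<^sup>2 - 1\<close> and \<open>y = q * x\<close>. After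
    clearing denominators this is all that \<open>\<beta>_rec\<close> says.\<close>
  have rel: "D' + q * z = q\<^sup>2 * D"
    using q_nz \<nu>_nz by (simp add: D_def D'_def yx z power2_eq_square field_simps)
  show "\<beta> x * ((y\<^sup>2 - 1) / z) + q * \<beta> x * \<beta> y = q\<^sup>2 * ((x\<^sup>2 - 1) / z) * \<beta> y"
  proof -
    have "\<beta> x * ((y\<^sup>2 - 1) / z) + q * \<beta> x * \<beta> y
        = (x\<^sup>2 - 1) * (y\<^sup>2 - 1) * (D' + q * z) / (D * D' * z)"
      unfolding b using D z_nz by (simp add: field_simps)
    also have "\<dots> = q\<^sup>2 * ((x\<^sup>2 - 1) / z) * \<beta> y"
      unfolding b rel using D z_nz by (simp add: field_simps)
    finally show ?thesis .
  qed
  show "\<nu> * (\<beta> y - (y\<^sup>2 - 1)) = q * \<beta> y * x\<^sup>2"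
  proof -
    have "\<nu> * (1 - D') = q * x\<^sup>2"
      using q_nz \<nu>_nz by (simp add: D'_def yx power2_eq_square field_simps)
    \<comment> \<open>Here \<open>\<beta> y * D' = y\<^sup>2 - 1\<close> is substituted.\<close>
    moreover have "\<nu> * (\<beta> y - (y\<^sup>2 - 1)) = \<nu> * (1 - D') * \<beta> y"
      unfolding b using D by (simp add: field_simps)
    ultimately show ?thesis by (simp add: mult_ac)
  qed
qed (use z \<nu>_q k_closed quad s_k k_s comm_s_k r_eq kts_kl tsl_kts stk_lst lst_lk stkts_l in
    \<open>simp_all add: t_def l_def\<close>)

end

text \<open>With \<open>k\<close> and \<beta> zero, all relations involving them are trivial,
  \<open>\<beta>_q\<close> and \<open>\<beta>_lin\<close> hold because \<nu> is zero too, and this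
  \<nu> differs from \<open>q\<close> because \<open>q\<close> is nonzero.\<close>

lemma (in braid_system) hecke_baxter_system:
  assumes z: "z = q - inverse q"
    and quad: "\<And>i. i \<in> {1..n} \<Longrightarrow> s i \<otimes> s i = z \<odot> s i \<oplus> \<one>"
  shows "baxter_system A q n s r \<chi> (\<lambda>_. \<zero>) 0 z (\<lambda>_. 0)"
proof -
  have r_eq: "r i = s i \<oplus> (- z) \<odot> \<one>" if i: "i \<in> {1..n}" for i
  proof -
    note c = s_closed[OF i]
    have "s i \<otimes> (s i \<oplus> (- z) \<odot> \<one>) = (z \<odot> s i \<oplus> (- z) \<odot> s i) \<oplus> \<one>"
      using c by (simp add: r_distr mult_smult quad[OF i] a_ac)
    also have "\<dots> = \<one>" using c by (simp add: smult_l_distr[symmetric])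
    finally show ?thesis using inv_unique[OF r_s[OF i]] c r_closed[OF i] by simp
  qed
  show ?thesis
    by (intro baxter_system.intro baxter_system_axioms.intro braid_system_axioms)
      (use z q_nz r_eq quad s_closed r_closed in \<open>simp_all add: a_comm\<close>)
qed

subsection \<open>The symmetrizer formula\<close>

lemma braid_algebra_facts:
  fixes R :: "('k::field, braid_word set \<Rightarrow>\<^sub>0 'k) module" and q :: 'k
  assumes R: "R = braid_algebra N" and q: "q \<noteq> 0" and i: "i \<in> {1..<N}"
  shows "braid_elt N i \<in> carrier R" "braid_word_elt N [(i, False)] \<in> carrier R"
    "braid_elt N i \<otimes>\<^bsub>R\<^esub> braid_word_elt N [(i, False)] = \<one>\<^bsub>R\<^esub>"
    "braid_word_elt N [(i, False)] \<otimes>\<^bsub>R\<^esub> braid_elt N i = \<one>\<^bsub>R\<^esub>"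
    "braid_char q (braid_elt N i) = q" "braid_char q (braid_word_elt N [(i, False)]) = inverse q"
proof -
  have w: "[(i, b)] \<in> braid_words N" for b using i by (simp add: braid_words_def)
  have rel: "([(i, True), (i, False)], []) \<in> braid_rel N" "([(i, False), (i, True)], []) \<in> braid_rel N"
    using braid_rel.cancel[OF i, of True] braid_rel.cancel[OF i, of False] by simp_all
  show "braid_elt N i \<in> carrier R" "braid_word_elt N [(i, False)] \<in> carrier R"
    "braid_elt N i \<otimes>\<^bsub>R\<^esub> braid_word_elt N [(i, False)] = \<one>\<^bsub>R\<^esub>"
    "braid_word_elt N [(i, False)] \<otimes>\<^bsub>R\<^esub> braid_elt N i = \<one>\<^bsub>R\<^esub>"
    "braid_char q (braid_elt N i) = q" "braid_char q (braid_word_elt N [(i, False)]) = inverse q"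
    using q by (simp_all add: R braid_elt_eq braid_word_elt_closed w braid_word_elt_mult
        braid_word_elt_Nil braid_word_elt_eq[OF rel(1)] braid_word_elt_eq[OF rel(2)]
        braid_char_word word_weight_def)
qed

lemma braid_char_linear:
  "braid_char q (f \<oplus>\<^bsub>braid_algebra N\<^esub> g) = braid_char q f + braid_char q g"
  "braid_char q (c \<odot>\<^bsub>braid_algebra N\<^esub> f) = c * braid_char q f"
  by (simp_all add: group_algebra_simps braid_char_add braid_char_scale)

lemma braid_char_minus:
  assumes "f \<in> carrier (braid_algebra N)" "g \<in> carrier (braid_algebra N)"
  shows "braid_char q (f \<ominus>\<^bsub>braid_algebra N\<^esub> g) = braid_char q f - braid_char q g"
proof -
  interpret R: scalar_algebra "braid_algebra N"
    by (rule scalar_algebra_group_algebra[OF monoid_braid_group])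
  show ?thesis using assms by (simp add: R.minus_smult braid_char_linear)
qed

lemma braid_char_one:
  assumes "q \<noteq> 0" shows "braid_char q \<one>\<^bsub>braid_algebra N\<^esub> = 1"
proof -
  have "[] \<in> braid_words N" by (simp add: braid_words_def)
  then show ?thesis
    using assms by (simp add: braid_word_elt_Nil braid_char_word word_weight_def)
qed

lemmas braid_char_algebra = braid_char_linear braid_char_minus braid_char_one
  braid_char_mult[where n = N for N]

text \<open>\<open>kappa\<close> refers to the inverse in the algebra at hand; the coset of the
  explicit inverse \<open>y\<close> is the inverse of the coset of \<open>x\<close>.\<close>

lemma (in algebra_ideal) kappa_proj:
  assumes "x \<in> carrier R" "y \<in> carrier R" "x \<otimes> y = \<one>" "y \<otimes> x = \<one>"
  shows "kappa Q q (I +> x) = I +> kappa R q x"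
proof -
  interpret Q: scalar_algebra Q by (rule scalar_algebra_quotient)
  show ?thesis
    using assms Q.kappa_eq[of "I +> x" "I +> y" q]
    by (simp add: kappa_eq[OF assms] proj_closed proj_mult proj_add proj_smult proj_one)
qed

text \<open>The character is \<open>q\<close> on each generator of the braid group, and q^2 - ((q -
  1/q) q + 1) = 0 puts the defining relation into its kernel.\<close>

lemma hecke_ideal_properties:
  fixes q :: "'k::field"
  assumes q: "q \<noteq> 0"
  shows "ideal (hecke_ideal N q) (braid_algebra N)"
    and "f \<in> hecke_ideal N q \<Longrightarrow> braid_char q f = 0"
    and "i \<in> {1..<N} \<Longrightarrow> braid_elt N i \<otimes>\<^bsub>braid_algebra N\<^esub> braid_elt N i \<ominus>\<^bsub>braid_algebra N\<^esub>
      ((q - inverse q) \<odot>\<^bsub>braid_algebra N\<^esub> braid_elt N i \<oplus>\<^bsub>braid_algebra N\<^esub> \<one>\<^bsub>braid_algebra N\<^esub>)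
      \<in> hecke_ideal N q"
proof -
  let ?R = "braid_algebra N :: ('k, _) module"
  let ?s = "braid_elt N :: nat \<Rightarrow> _ \<Rightarrow>\<^sub>0 'k"
  let ?K = "{f \<in> carrier ?R. braid_char q f = 0}"
  interpret R: scalar_algebra ?R
    by (rule scalar_algebra_group_algebra[OF monoid_braid_group])
  define H where "H = {?s i \<otimes>\<^bsub>?R\<^esub> ?s i \<ominus>\<^bsub>?R\<^esub> ((q - inverse q) \<odot>\<^bsub>?R\<^esub> ?s i \<oplus>\<^bsub>?R\<^esub> \<one>\<^bsub>?R\<^esub>) |i. i \<in> {1..<N}}"
  have I: "hecke_ideal N q = Idl\<^bsub>?R\<^esub> H" by (simp add: hecke_ideal_def H_def Let_def)
  have HK: "H \<subseteq> ?K"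
    using q unfolding H_def
    by (auto simp: braid_algebra_facts[OF HOL.refl q] braid_char_algebra left_diff_distrib)
  then have HR: "H \<subseteq> carrier ?R" by auto
  show "ideal (hecke_ideal N q) ?R" unfolding I by (rule R.genideal_ideal[OF HR])
  have "hecke_ideal N q \<subseteq> ?K"
    unfolding I by (rule R.genideal_minimal[OF ideal_braid_char_kernel[OF q] HK])
  then show "f \<in> hecke_ideal N q \<Longrightarrow> braid_char q f = 0" by auto
  show "i \<in> {1..<N} \<Longrightarrow> ?s i \<otimes>\<^bsub>?R\<^esub> ?s i \<ominus>\<^bsub>?R\<^esub> ((q - inverse q) \<odot>\<^bsub>?R\<^esub> ?s i \<oplus>\<^bsub>?R\<^esub> \<one>\<^bsub>?R\<^esub>) \<in> hecke_ideal N q"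
    using R.genideal_self[OF HR] unfolding I H_def by blast
qed

text \<open>The character kills every kappa, because 1 - (q - 1/q)/(q - 1/q) = 0, and each term of
  each defining relation contains a kappa; hence the relations lie in the kernel for any
  \<nu>.\<close>

lemma bmw_ideal_properties:
  fixes q \<nu> :: "'k::field" and N :: nat
  assumes q: "q \<noteq> 0" "q\<^sup>2 \<noteq> 1"
  defines "R \<equiv> braid_algebra N :: ('k, _) module"
  defines "s \<equiv> braid_elt N :: nat \<Rightarrow> _ \<Rightarrow>\<^sub>0 'k"
  defines "k \<equiv> \<lambda>i. kappa R q (s i)"
  shows "ideal (bmw_ideal N q \<nu>) R"
    and "f \<in> bmw_ideal N q \<nu> \<Longrightarrow> braid_char q f = 0"
    and "i \<in> {1..<N} \<Longrightarrow> k i \<otimes>\<^bsub>R\<^esub> s i \<ominus>\<^bsub>R\<^esub> \<nu> \<odot>\<^bsub>R\<^esub> k i \<in> bmw_ideal N q \<nu>"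
    and "i \<in> {1..<N} \<Longrightarrow> s i \<otimes>\<^bsub>R\<^esub> k i \<ominus>\<^bsub>R\<^esub> \<nu> \<odot>\<^bsub>R\<^esub> k i \<in> bmw_ideal N q \<nu>"
    and "i \<in> {2..<N} \<Longrightarrow>
      k i \<otimes>\<^bsub>R\<^esub> s (i - 1) \<otimes>\<^bsub>R\<^esub> k i \<ominus>\<^bsub>R\<^esub> inverse \<nu> \<odot>\<^bsub>R\<^esub> k i \<in> bmw_ideal N q \<nu>"
    and "i \<in> {2..<N} \<Longrightarrow>
      k i \<otimes>\<^bsub>R\<^esub> inv\<^bsub>R\<^esub> (s (i - 1)) \<otimes>\<^bsub>R\<^esub> k i \<ominus>\<^bsub>R\<^esub> \<nu> \<odot>\<^bsub>R\<^esub> k i \<in> bmw_ideal N q \<nu>"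
    and "i \<in> {1..<N} \<Longrightarrow> k i \<in> carrier R"
    and "i \<in> {1..<N} \<Longrightarrow> inv\<^bsub>R\<^esub> (s i) = braid_word_elt N [(i, False)]"
proof -
  let ?K = "{f \<in> carrier R. braid_char q f = 0}"
  interpret R: scalar_algebra R
    unfolding R_def by (rule scalar_algebra_group_algebra[OF monoid_braid_group])
  note facts = braid_algebra_facts[OF R_def[THEN meta_eq_to_obj_eq] q(1), folded s_def]
  note char = braid_char_algebra[where N = N and q = q, folded R_def]
  have z: "q - inverse q \<noteq> 0" using q by (auto simp: field_simps power2_eq_square)
  have inv: "inv\<^bsub>R\<^esub> (s i) = braid_word_elt N [(i, False)]" if "i \<in> {1..<N}" for i
    by (rule R.inv_eqI) (use facts[OF that] in auto)
  have k_eq: "k i = \<one>\<^bsub>R\<^esub> \<oplus>\<^bsub>R\<^esub> (- inverse (q - inverse q)) \<odot>\<^bsub>R\<^esub> s i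
      \<oplus>\<^bsub>R\<^esub> inverse (q - inverse q) \<odot>\<^bsub>R\<^esub> braid_word_elt N [(i, False)]" if "i \<in> {1..<N}" for i
    unfolding k_def by (rule R.kappa_eq) (use facts[OF that] in auto)
  have k_closed: "k i \<in> carrier R" if "i \<in> {1..<N}" for i
    using facts[OF that] by (simp add: k_eq[OF that])
  have k_char: "braid_char q (k i) = 0" if "i \<in> {1..<N}" for i
  proof -
    let ?z = "q - inverse q"
    have "braid_char q (k i) = 1 + (- inverse ?z) * q + inverse ?z * inverse q"
      using facts[OF that] q(1) by (simp add: k_eq[OF that] char)
    also have "\<dots> = 1 - inverse ?z * ?z" by (simp only: right_diff_distrib) simp
    finally show ?thesis using z by simp
  qed
  define H where "H = {k i \<otimes>\<^bsub>R\<^esub> s i \<ominus>\<^bsub>R\<^esub> \<nu> \<odot>\<^bsub>R\<^esub> k i | i. i \<in> {1..<N}} \<union>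
       {s i \<otimes>\<^bsub>R\<^esub> k i \<ominus>\<^bsub>R\<^esub> \<nu> \<odot>\<^bsub>R\<^esub> k i | i. i \<in> {1..<N}} \<union>
       {k i \<otimes>\<^bsub>R\<^esub> s (i - 1) \<otimes>\<^bsub>R\<^esub> k i \<ominus>\<^bsub>R\<^esub> inverse \<nu> \<odot>\<^bsub>R\<^esub> k i | i. i \<in> {2..<N}} \<union>
       {k i \<otimes>\<^bsub>R\<^esub> inv\<^bsub>R\<^esub> (s (i - 1)) \<otimes>\<^bsub>R\<^esub> k i \<ominus>\<^bsub>R\<^esub> \<nu> \<odot>\<^bsub>R\<^esub> k i | i. i \<in> {2..<N}}"
  have I: "bmw_ideal N q \<nu> = Idl\<^bsub>R\<^esub> H"
    by (simp add: bmw_ideal_def H_def Let_def R_def s_def k_def)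
  have "i \<in> {1..<N}" "i - 1 \<in> {1..<N}" if "i \<in> {2..<N}" for i using that by auto
  note this[THEN facts(1)] this[THEN facts(2)] this[THEN k_closed] this[THEN k_char] this[THEN inv]
  then have HK: "H \<subseteq> ?K"
    unfolding H_def using q(1) by (auto simp: facts k_closed k_char inv char)
  then have HR: "H \<subseteq> carrier R" by auto
  show "ideal (bmw_ideal N q \<nu>) R" unfolding I by (rule R.genideal_ideal[OF HR])
  have "bmw_ideal N q \<nu> \<subseteq> ?K"
    unfolding I
    by (rule R.genideal_minimal[OF ideal_braid_char_kernel[OF q(1), of N, folded R_def] HK])
  then show "f \<in> bmw_ideal N q \<nu> \<Longrightarrow> braid_char q f = 0" by auto
  have "H \<subseteq> bmw_ideal N q \<nu>" unfolding I by (rule R.genideal_self[OF HR])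
  then show "i \<in> {1..<N} \<Longrightarrow> k i \<otimes>\<^bsub>R\<^esub> s i \<ominus>\<^bsub>R\<^esub> \<nu> \<odot>\<^bsub>R\<^esub> k i \<in> bmw_ideal N q \<nu>"
    and "i \<in> {1..<N} \<Longrightarrow> s i \<otimes>\<^bsub>R\<^esub> k i \<ominus>\<^bsub>R\<^esub> \<nu> \<odot>\<^bsub>R\<^esub> k i \<in> bmw_ideal N q \<nu>"
    and "i \<in> {2..<N} \<Longrightarrow>
      k i \<otimes>\<^bsub>R\<^esub> s (i - 1) \<otimes>\<^bsub>R\<^esub> k i \<ominus>\<^bsub>R\<^esub> inverse \<nu> \<odot>\<^bsub>R\<^esub> k i \<in> bmw_ideal N q \<nu>"
    and "i \<in> {2..<N} \<Longrightarrow>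
      k i \<otimes>\<^bsub>R\<^esub> inv\<^bsub>R\<^esub> (s (i - 1)) \<otimes>\<^bsub>R\<^esub> k i \<ominus>\<^bsub>R\<^esub> \<nu> \<odot>\<^bsub>R\<^esub> k i \<in> bmw_ideal N q \<nu>"
    unfolding H_def by blast+
  show "i \<in> {1..<N} \<Longrightarrow> k i \<in> carrier R"
    and "i \<in> {1..<N} \<Longrightarrow> inv\<^bsub>R\<^esub> (s i) = braid_word_elt N [(i, False)]"
    using k_closed inv by auto
qed

section \<open>Both algebras as instances of the common frame\<close>

lemma shuffle1_cong:
  assumes "\<And>i. i \<in> {1..n} \<Longrightarrow> b i (q ^ i) = b' i (q ^ i)"
  shows "shuffle1 A q b n = shuffle1 A q b' n"
  unfolding shuffle1_def using assms by (intro foldr_cong) auto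

lemma hecke_symmetrizer:
  fixes q :: "'k::field"
  assumes N: "N = n + 1" and q: "q \<noteq> 0" "q\<^sup>2 \<noteq> 1" "\<forall>k\<in>{2..n + 1}. qnum q k \<noteq> 0"
  defines "A \<equiv> hecke_algebra N q" and "s \<equiv> hecke_gen N q" and "b \<equiv> hecke_baxter N q"
  shows "(\<exists>!S. is_symmetrizer A q s n S) \<and>
    symmetrizer A q s n = (inverse (qfact q (n + 1)) \<odot>\<^bsub>A\<^esub> shuffle1 A q b n) [^]\<^bsub>A\<^esub> n"
proof -
  let ?R = "braid_algebra N :: ('k, _) module"
  let ?I = "hecke_ideal N q"
  define r where "r i = ?I +>\<^bsub>?R\<^esub> braid_word_elt N [(i, False)]" for i
  define \<chi> where "\<chi> = (\<lambda>U. the_elem (braid_char q ` U))"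
  define z where "z = q - inverse q"
  have A: "A = quotient_algebra ?R ?I" and s: "s = (\<lambda>i. ?I +>\<^bsub>?R\<^esub> braid_elt N i)"
    by (simp_all add: A_def s_def hecke_algebra_def hecke_gen_def fun_eq_iff)
  interpret I: algebra_ideal ?R ?I
    by (intro algebra_ideal.intro scalar_algebra_group_algebra[OF monoid_braid_group]
        hecke_ideal_properties q)
  interpret braid_system A q n s r \<chi>
    unfolding A s r_def[abs_def] \<chi>_def
    using hecke_ideal_properties[OF q(1), where N = N] q by (intro braid_system_quotient N) auto
  have quad: "s i \<otimes>\<^bsub>A\<^esub> s i = z \<odot>\<^bsub>A\<^esub> s i \<oplus>\<^bsub>A\<^esub> \<one>\<^bsub>A\<^esub>" if "i \<in> {1..n}" for i
  proof -
    have i: "i \<in> {1..<N}" using that N by auto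
    note c = braid_algebra_facts(1)[OF HOL.refl q(1) i]
    show ?thesis
      unfolding A s z_def
      using c I.proj_eqI[OF _ _ hecke_ideal_properties(3)[OF q(1) i]]
      by (simp add: I.proj_simps I.proj_one)
  qed
  interpret baxter_system A q n s r \<chi> "\<lambda>_. \<zero>\<^bsub>A\<^esub>" 0 z "\<lambda>_. 0"
    by (rule hecke_baxter_system[OF z_def quad])
  \<comment> \<open>Substituting \<open>r i\<close> = s - z in (x s - r/x)/z turns it into 1/x + ((x
    - 1/x)/z) s, the form of \<open>sig\<close> without the kappa term.\<close>
  have "b i x = sig i x" if i: "i \<in> {1..n}" and x: "x \<noteq> 0" for i x
  proof -
    note c = s_closed[OF i] r_closed[OF i]
    let ?L = "combo \<one>\<^bsub>A\<^esub> (s i) \<zero>\<^bsub>A\<^esub> \<zero>\<^bsub>A\<^esub> \<zero>\<^bsub>A\<^esub> \<zero>\<^bsub>A\<^esub>"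
    have "b i x = inverse z \<odot>\<^bsub>A\<^esub> (x \<odot>\<^bsub>A\<^esub> s i \<oplus>\<^bsub>A\<^esub> (- inverse x) \<odot>\<^bsub>A\<^esub> r i)"
      using c inv_eqI[OF c s_r[OF i] r_s[OF i]]
      by (simp add: b_def hecke_baxter_def Let_def z_def minus_smult smult_smult flip: A_def s_def)
    also have "\<dots> = inverse z \<odot>\<^bsub>A\<^esub> (?L 0 x 0 0 0 0 \<oplus>\<^bsub>A\<^esub> ?L (inverse x * z) (- inverse x) 0 0 0 0)"
      unfolding r_eq[OF i] using c
      by (simp add: combo_def smult_r_distr smult_smult a_comm)
    also have "\<dots> = ?L (inverse x) (inverse z * (x - inverse x)) 0 0 0 0"
      using c z_nz by (simp add: combo_simps field_simps)
    also have "inverse z * (x - inverse x) = inverse x * ((x\<^sup>2 - 1) / z)"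
      using x z_nz by (simp add: field_simps power2_eq_square)
    also have "?L (inverse x) (inverse x * ((x\<^sup>2 - 1) / z)) 0 0 0 0 = sig i x"
      using c by (simp add: sig_def combo_def smult_r_distr smult_smult flip: z_def)
    finally show ?thesis .
  qed
  then have "shuffle1 A q b n = shuffle1 A q sig n"
    using q by (intro shuffle1_cong) auto
  then show ?thesis using symmetrizer_eq_shuffle_pow by simp
qed

lemma bmw_symmetrizer:
  fixes q \<nu> :: "'k::field"
  assumes N: "N = n + 1" and q: "q \<noteq> 0" "q\<^sup>2 \<noteq> 1" "\<forall>k\<in>{2..n + 1}. qnum q k \<noteq> 0"
    and \<nu>: "\<nu> \<noteq> 0" "\<nu> \<noteq> q" "\<forall>j\<in>{1..n}. \<nu> \<noteq> q ^ (2 * j - 1)"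
  defines "A \<equiv> bmw_algebra N q \<nu>" and "s \<equiv> bmw_gen N q \<nu>" and "b \<equiv> bmw_baxter N q \<nu>"
  shows "(\<exists>!S. is_symmetrizer A q s n S) \<and>
    symmetrizer A q s n = (inverse (qfact q (n + 1)) \<odot>\<^bsub>A\<^esub> shuffle1 A q b n) [^]\<^bsub>A\<^esub> n"
proof -
  let ?R = "braid_algebra N :: ('k, _) module"
  let ?I = "bmw_ideal N q \<nu>"
  let ?\<sigma> = "braid_elt N :: nat \<Rightarrow> _ \<Rightarrow>\<^sub>0 'k"
  let ?\<rho> = "\<lambda>i. braid_word_elt N [(i, False)] :: _ \<Rightarrow>\<^sub>0 'k"
  let ?\<kappa> = "\<lambda>i. kappa ?R q (?\<sigma> i)"
  define r where "r i = ?I +>\<^bsub>?R\<^esub> ?\<rho> i" for i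
  define \<chi> where "\<chi> = (\<lambda>U. the_elem (braid_char q ` U))"
  define z where "z = q - inverse q"
  define k where "k i = kappa A q (s i)" for i
  have A: "A = quotient_algebra ?R ?I" and s: "s = (\<lambda>i. ?I +>\<^bsub>?R\<^esub> ?\<sigma> i)"
    by (simp_all add: A_def s_def bmw_algebra_def bmw_gen_def fun_eq_iff)
  note ideal = bmw_ideal_properties[OF q(1,2)]
  interpret I: algebra_ideal ?R ?I
    by (intro algebra_ideal.intro scalar_algebra_group_algebra[OF monoid_braid_group] ideal)
  interpret braid_system A q n s r \<chi>
    unfolding A s r_def[abs_def] \<chi>_def
    using ideal(1,2) q by (intro braid_system_quotient N) auto
  have k: "k i = ?I +>\<^bsub>?R\<^esub> ?\<kappa> i" if "i \<in> {1..<N}" for i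
    unfolding k_def A s by (rule I.kappa_proj) (use braid_algebra_facts[OF HOL.refl q(1) that] in auto)
  note facts = braid_algebra_facts(1,2)[OF HOL.refl q(1)] ideal(7)
  interpret bmw_system A q n s r \<chi> k \<nu> z
  proof (intro bmw_system.intro bmw_system_axioms.intro braid_system_axioms)
    fix i assume "i \<in> {1..n}"
    then have i: "i \<in> {1..<N}" using N by auto
    show "k i \<otimes>\<^bsub>A\<^esub> s i = \<nu> \<odot>\<^bsub>A\<^esub> k i"
      unfolding k[OF i] unfolding A s
      using facts[OF i] I.proj_eqI[OF _ _ ideal(3)[OF i]] by (simp add: I.proj_simps)
    show "s i \<otimes>\<^bsub>A\<^esub> k i = \<nu> \<odot>\<^bsub>A\<^esub> k i"
      unfolding k[OF i] unfolding A s
      using facts[OF i] I.proj_eqI[OF _ _ ideal(4)[OF i]] by (simp add: I.proj_simps)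
  next
    fix i assume "i \<in> {1..<n}"
    \<comment> \<open>The presentation uses the indices \<open>i\<close> and \<open>i - 1\<close>
      with \<open>i\<close> from 2 on; taking \<open>Suc i\<close> removes the subtraction.\<close>
    then have i: "i \<in> {1..<N}" "Suc i \<in> {1..<N}" "Suc i \<in> {2..<N}" using N by auto
    have inv: "inv\<^bsub>?R\<^esub> (?\<sigma> i) = ?\<rho> i" by (rule ideal(8)[OF i(1)])
    show "k (Suc i) \<otimes>\<^bsub>A\<^esub> (s i \<otimes>\<^bsub>A\<^esub> k (Suc i)) = inverse \<nu> \<odot>\<^bsub>A\<^esub> k (Suc i)"
      unfolding k[OF i(2)] unfolding A s
      using facts[OF i(1)] facts[OF i(2)] I.proj_eqI[OF _ _ ideal(5)[OF i(3)]]
      by (simp add: I.proj_simps I.m_assoc)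
    show "k (Suc i) \<otimes>\<^bsub>A\<^esub> (r i \<otimes>\<^bsub>A\<^esub> k (Suc i)) = \<nu> \<odot>\<^bsub>A\<^esub> k (Suc i)"
      unfolding k[OF i(2)] r_def unfolding A
      using facts[OF i(1)] facts[OF i(2)] I.proj_eqI[OF _ _ ideal(6)[OF i(3)]]
      by (simp add: I.proj_simps I.m_assoc inv)
  qed (use \<nu> z_def k_def in auto)
  interpret B: baxter_system A q n s r \<chi> k \<nu> z \<beta> by (rule baxter_system)
  have "b = B.sig"
    by (simp add: b_def bmw_baxter_def B.sig_def \<beta>_def Let_def k_def fun_eq_iff flip: A_def s_def)
  then show ?thesis using B.symmetrizer_eq_shuffle_pow by simp
qed

theorem mainTheorem3:
  fixes q :: "'k::field" and n :: nat
  assumes "n \<ge> 1"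
    and "q \<noteq> 0"
    and "q\<^sup>2 \<noteq> 1"
    and "\<forall>k\<in>{2..n + 1}. qnum q k \<noteq> 0"
  shows
    "(let A = hecke_algebra (n + 1) q; s = hecke_gen (n + 1) q; b = hecke_baxter (n + 1) q in
        (\<exists>!S. is_symmetrizer A q s n S) \<and>
        symmetrizer A q s n =
          (inverse (qfact q (n + 1)) \<odot>\<^bsub>A\<^esub> shuffle1 A q b n) [^]\<^bsub>A\<^esub> n) \<and>
     (\<forall>\<nu>. \<nu> \<notin> {0, q, - inverse q} \<and> (\<forall>j\<in>{1..n}. \<nu> \<noteq> q ^ (2 * j - 1)) \<longrightarrow>
       (let A = bmw_algebra (n + 1) q \<nu>; s = bmw_gen (n + 1) q \<nu>; b = bmw_baxter (n + 1) q \<nu> in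
          (\<exists>!S. is_symmetrizer A q s n S) \<and>
          symmetrizer A q s n =
            (inverse (qfact q (n + 1)) \<odot>\<^bsub>A\<^esub> shuffle1 A q b n) [^]\<^bsub>A\<^esub> n))"
  unfolding Let_def
proof (rule conjI, goal_cases)
  case 1
  show ?case by (rule hecke_symmetrizer[OF HOL.refl assms(2-4)])
next
  case 2
  show ?case
  proof (rule allI, rule impI, elim conjE)
    fix \<nu> assume "\<nu> \<notin> {0, q, - inverse q}" and pow: "\<forall>j\<in>{1..n}. \<nu> \<noteq> q ^ (2 * j - 1)"
    then have "\<nu> \<noteq> 0" "\<nu> \<noteq> q" by auto
    then show "(\<exists>!S. is_symmetrizer (bmw_algebra (n + 1) q \<nu>) q (bmw_gen (n + 1) q \<nu>) n S) \<and>
        symmetrizer (bmw_algebra (n + 1) q \<nu>) q (bmw_gen (n + 1) q \<nu>) n =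
          (inverse (qfact q (n + 1)) \<odot>\<^bsub>bmw_algebra (n + 1) q \<nu>\<^esub>
            shuffle1 (bmw_algebra (n + 1) q \<nu>) q (bmw_baxter (n + 1) q \<nu>) n)
          [^]\<^bsub>bmw_algebra (n + 1) q \<nu>\<^esub> n"
      by (rule bmw_symmetrizer[OF HOL.refl assms(2-4) _ _ pow])
  qed
qed

end
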